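(* If $(\alpha,\beta)\in\{(1,1),(1,\omega),(\omega,1)\}$ and $(\gamma,\delta)\in\{(1,<\omega),(1,\omega|<\omega),(<\omega,1),(<\omega,\omega)\}$, then there is an elementary difference between $\mathcal D^\alpha_\beta$ and $\mathcal D^\gamma_\delta$ in the language of partial orderings $\{\le\}$; that is, some first-order sentence in the language $\{\le\}$ is true in one of them and false in the other.
   Context: Let $\{\Phi_e\}_{e\in\mathbb N}$ be an effective enumeration of all partial computable functions $\Phi_e:\subseteq\mathbb N^{\mathbb N}\to\mathbb N^{\mathbb N}$. A learner is a total computable function $\Psi:\mathbb N^{<\mathbb N}\to\mathbb N$; let $\{\Psi_e\}_{e\in\mathbb N}$ be an effective enumeration of all learners. A partial function $\Gamma:\subseteq\mathbb N^{\mathbb N}\to\mathbb N^{\mathbb N}$ is identified by $\Psi$ on $g$ if $\lim_n\Psi(g\upharpoonright n)$ exists and $\Phi_{\lim_n\Psi(g\upharpoonright n)}(g)=\Gamma(g)$, and is identified by $\Psi$ if this holds for every $g\in\mathrm{dom}(\Gamma)$. Then $\Gamma$ is: - $(1,1)$-computable if it is computable; - $(1,<\omega)$-computable if it is identified by a learner $\Psi$ with $\sup_{g\in\mathrm{dom}(\Gamma)}\#\{n:\Psi(g\upharpoonright (n+1))\neq\Psi(g\upharpoonright n)\}<\omega$; - $(1,\omega|<\omega)$-computable if it is identified by a learner $\Psi$ with $\sup_{g\in\mathrm{dom}(\Gamma)}\#\{\Psi(g\upharpoonright n):n\in\mathbb N\}<\omega$; - $(1,\omega)$-computable if it is identified by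 a learner; - $(<\omega,1)$-computable if there is $b\in\mathbb N$ such that for every $g\in\mathrm{dom}(\Gamma)$, $\Gamma(g)=\Phi_e(g)$ for some $e<b$; - $(<\omega,\omega)$-computable if there is $b\in\mathbb N$ such that for every $g\in\mathrm{dom}(\Gamma)$, $\Gamma$ is identified by $\Psi_e$ on $g$ for some $e<b$; - $(\omega,1)$-computable if $\Gamma(g)\le_Tg$ for every $g\in\mathrm{dom}(\Gamma)$. For each such notion $(\alpha,\beta)$ (where $\beta$ may be $\omega|<\omega$) and $A,B\subseteq\mathbb N^{\mathbb N}$, $A\le^\alpha_\beta B$ means there is an $(\alpha,\beta)$-computable $\Gamma$ with $B\subseteq\mathrm{dom}(\Gamma)$ and $\Gamma(g)\in A$ for every $g\in B$. $\mathcal D^\alpha_\beta$ is the partial order obtained by quotienting the set of all subsets of $\mathbb N^{\mathbb N}$, preordered by $\le^\alpha_\beta$, by the induced equivalence relation. *)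

theory Defs
  imports Main "HOL-Library.Nat_Bijection"
begin

section \<open>Partial computable functions on Baire space\<close>

type_synonym baire = "nat \<Rightarrow> nat"

text \<open>
  Oracle programs are terms for partial recursive functions relative to an oracle. They take one
  number as input; tuples are passed via the Cantor pairing \<^const>\<open>prod_encode\<close>.
\<close>

datatype prog =
    Zero | Succ | Left | Right | Oracle
  | Tuple prog prog | Comp prog prog | PrimRec prog prog | Minim prog

inductive evals :: "baire \<Rightarrow> prog \<Rightarrow> nat \<Rightarrow> nat \<Rightarrow> bool" for g :: baire where
  Zero: "evals g Zero x 0"
| Succ: "evals g Succ x (Suc x)"
| Left: "evals g Left x (fst (prod_decode x))"
| Right: "evals g Right x (snd (prod_decode x))"
| Oracle: "evals g Oracle x (g x)"
| Tuple: "evals g p x y \<Longrightarrow> evals g q x z \<Longrightarrow> evals g (Tuple p q) x (prod_encode (y, z))"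
| Comp: "evals g q x y \<Longrightarrow> evals g p y z \<Longrightarrow> evals g (Comp p q) x z"
| PrimRec_0: "evals g p a y \<Longrightarrow> evals g (PrimRec p q) (prod_encode (a, 0)) y"
| PrimRec_Suc: "evals g (PrimRec p q) (prod_encode (a, n)) y
    \<Longrightarrow> evals g q (prod_encode (a, prod_encode (n, y))) z
    \<Longrightarrow> evals g (PrimRec p q) (prod_encode (a, Suc n)) z"
| Minim: "evals g p (prod_encode (a, n)) 0
    \<Longrightarrow> (\<forall>m<n. \<exists>y. evals g p (prod_encode (a, m)) (Suc y))
    \<Longrightarrow> evals g (Minim p) a n"

lemma evals_deterministic: "evals g p x y \<Longrightarrow> evals g p x z \<Longrightarrow> y = z"
proof (induction arbitrary: z rule: evals.induct)
  case (Tuple p x y q z')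
  from Tuple.prems Tuple.IH show ?case by (auto elim: evals.cases)
next
  case (Comp q x y p z')
  from Comp.prems Comp.IH show ?case by (auto elim: evals.cases)
next
  case (PrimRec_0 p a y q)
  from PrimRec_0.prems PrimRec_0.IH show ?case by (auto elim: evals.cases)
next
  case (PrimRec_Suc p q a n y z')
  from PrimRec_Suc.prems obtain y' where "evals g (PrimRec p q) (prod_encode (a, n)) y'"
    "evals g q (prod_encode (a, prod_encode (n, y'))) z"
    by (cases rule: evals.cases) auto
  with PrimRec_Suc.IH show ?case by metis
next
  case (Minim p a n)
  from Minim.prems have z: "evals g p (prod_encode (a, z)) 0"
    "\<forall>m<z. \<exists>y. evals g p (prod_encode (a, m)) (Suc y)"
    by (auto elim: evals.cases)
  show ?case
  proof (rule linorder_cases[of n z])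
    assume "n < z"
    then show ?thesis using z(2) Minim.IH(1) by (metis nat.distinct(1))
  next
    assume "z < n"
    then show ?thesis using z(1) Minim.IH(2) by (metis nat.distinct(1))
  qed
qed (auto elim: evals.cases)

function prog_of :: "nat \<Rightarrow> prog" where
  "prog_of e =
    (if e = 0 then Zero else if e = 1 then Succ else if e = 2 then Left else if e = 3 then Right
     else if e = 4 then Oracle
     else let k = (e - 5) div 4; a = fst (prod_decode k); b = snd (prod_decode k) in
       if (e - 5) mod 4 = 0 then Tuple (prog_of a) (prog_of b)
       else if (e - 5) mod 4 = 1 then Comp (prog_of a) (prog_of b)
       else if (e - 5) mod 4 = 2 then PrimRec (prog_of a) (prog_of b)
       else Minim (prog_of k))"
  by pat_completeness auto
termination
proof -
  have k: "(e - 5) div 4 < e" if "e \<noteq> 0" for e :: nat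
    using that by linarith
  have "fst (prod_decode m) \<le> m" "snd (prod_decode m) \<le> m" for m
    using le_prod_encode_1[of "fst (prod_decode m)" "snd (prod_decode m)"]
      le_prod_encode_2[of "snd (prod_decode m)" "fst (prod_decode m)"] by simp_all
  with k show ?thesis
    by (relation "measure id") (auto intro: le_less_trans)
qed

declare prog_of.simps [simp del]

lemma surj_prog_of: "surj prog_of"
proof -
  have div4: "Suc (4 * m) div 4 = m" "Suc (Suc (4 * m)) div 4 = m"
      "Suc (Suc (Suc (4 * m))) div 4 = m" "(4 * m + 2) div 4 = m" "(4 * m + 3) div 4 = m" for m
    by presburger+
  have mod4: "Suc (4 * m) mod 4 = 1" "Suc (Suc (4 * m)) mod 4 = 2"
      "Suc (Suc (Suc (4 * m))) mod 4 = 3" for m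
    by presburger+
  have "\<exists>e. prog_of e = p" for p
  proof (induction p)
    case Zero show ?case by (rule exI[of _ 0]) (simp add: prog_of.simps)
  next
    case Succ show ?case by (rule exI[of _ 1]) (simp add: prog_of.simps)
  next
    case Left show ?case by (rule exI[of _ 2]) (simp add: prog_of.simps)
  next
    case Right show ?case by (rule exI[of _ 3]) (simp add: prog_of.simps)
  next
    case Oracle show ?case by (rule exI[of _ 4]) (simp add: prog_of.simps)
  next
    case (Tuple p q)
    then obtain a b where "prog_of a = p" "prog_of b = q" by blast
    then show ?case
      by (intro exI[of _ "5 + 4 * prod_encode (a, b)"]) (subst prog_of.simps, simp add: Let_def div4 mod4)
  next
    case (Comp p q)
    then obtain a b where "prog_of a = p" "prog_of b = q" by blast
    then show ?case
      by (intro exI[of _ "6 + 4 * prod_encode (a, b)"]) (subst prog_of.simps, simp add: Let_def div4 mod4)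
  next
    case (PrimRec p q)
    then obtain a b where "prog_of a = p" "prog_of b = q" by blast
    then show ?case
      by (intro exI[of _ "7 + 4 * prod_encode (a, b)"]) (subst prog_of.simps, simp add: Let_def div4 mod4)
  next
    case (Minim p)
    then obtain k where "prog_of k = p" by blast
    then show ?case
      by (intro exI[of _ "8 + 4 * k"]) (subst prog_of.simps, simp add: Let_def div4 mod4)
  qed
  then show ?thesis by (metis surjI)
qed

definition Phi :: "nat \<Rightarrow> baire \<rightharpoonup> baire" where
  "Phi e g = (if \<forall>x. \<exists>y. evals g (prog_of e) x y
              then Some (\<lambda>x. THE y. evals g (prog_of e) x y) else None)"

definition turing_le :: "baire \<Rightarrow> baire \<Rightarrow> bool" where
  "turing_le f g \<longleftrightarrow> (\<exists>e. Phi e g = Some f)"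


section \<open>Learners\<close>

text \<open>
  The total computable functions on finite sequences cannot be enumerated effectively by a total
  enumeration. As usual, index \<open>e\<close> denotes the function computed by the program with number \<open>e\<close>
  (running on the zero oracle), and it is an index of a learner only if that function is total.
\<close>

definition Psi :: "nat \<Rightarrow> (nat list \<Rightarrow> nat) option" where
  "Psi e = map_option (\<lambda>h \<sigma>. h (list_encode \<sigma>)) (Phi e (\<lambda>_. 0))"

definition learner :: "(nat list \<Rightarrow> nat) \<Rightarrow> bool" where
  "learner \<psi> \<longleftrightarrow> (\<exists>e. Psi e = Some \<psi>)"

definition restr :: "baire \<Rightarrow> nat \<Rightarrow> nat list" where
  "restr g n = map g [0..<n]"

definition identified_on :: "(nat list \<Rightarrow> nat) \<Rightarrow> (baire \<rightharpoonup> baire) \<Rightarrow> baire \<Rightarrow> bool" where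
  "identified_on \<psi> \<Gamma> g \<longleftrightarrow>
     (\<exists>i. (\<forall>\<^sub>F n in sequentially. \<psi> (restr g n) = i) \<and> Phi i g = \<Gamma> g)"

definition identified :: "(nat list \<Rightarrow> nat) \<Rightarrow> (baire \<rightharpoonup> baire) \<Rightarrow> bool" where
  "identified \<psi> \<Gamma> \<longleftrightarrow> (\<forall>g\<in>dom \<Gamma>. identified_on \<psi> \<Gamma> g)"


section \<open>Notions of computability for partial functions\<close>

definition computable_1_1 :: "(baire \<rightharpoonup> baire) \<Rightarrow> bool" where
  "computable_1_1 \<Gamma> \<longleftrightarrow> (\<exists>e. \<Gamma> = Phi e)"

definition computable_1_fin :: "(baire \<rightharpoonup> baire) \<Rightarrow> bool" where
  "computable_1_fin \<Gamma> \<longleftrightarrow> (\<exists>\<psi>. learner \<psi> \<and> identified \<psi> \<Gamma> \<and>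
     (\<exists>k. \<forall>g\<in>dom \<Gamma>. finite {n. \<psi> (restr g (n + 1)) \<noteq> \<psi> (restr g n)} \<and>
                      card {n. \<psi> (restr g (n + 1)) \<noteq> \<psi> (restr g n)} \<le> k))"

text \<open>Here \<open>omega_fin\<close> stands for \<open>\<omega>|<\<omega>\<close>: boundedly many hypotheses, no bound on mind changes.\<close>

definition computable_1_omega_fin :: "(baire \<rightharpoonup> baire) \<Rightarrow> bool" where
  "computable_1_omega_fin \<Gamma> \<longleftrightarrow> (\<exists>\<psi>. learner \<psi> \<and> identified \<psi> \<Gamma> \<and>
     (\<exists>k. \<forall>g\<in>dom \<Gamma>. finite (range (\<lambda>n. \<psi> (restr g n))) \<and>
                      card (range (\<lambda>n. \<psi> (restr g n))) \<le> k))"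

definition computable_1_omega :: "(baire \<rightharpoonup> baire) \<Rightarrow> bool" where
  "computable_1_omega \<Gamma> \<longleftrightarrow> (\<exists>\<psi>. learner \<psi> \<and> identified \<psi> \<Gamma>)"

definition computable_fin_1 :: "(baire \<rightharpoonup> baire) \<Rightarrow> bool" where
  "computable_fin_1 \<Gamma> \<longleftrightarrow> (\<exists>b. \<forall>g\<in>dom \<Gamma>. \<exists>e<b. \<Gamma> g = Phi e g)"

definition computable_fin_omega :: "(baire \<rightharpoonup> baire) \<Rightarrow> bool" where
  "computable_fin_omega \<Gamma> \<longleftrightarrow>
     (\<exists>b. \<forall>g\<in>dom \<Gamma>. \<exists>e<b. \<exists>\<psi>. Psi e = Some \<psi> \<and> identified_on \<psi> \<Gamma> g)"

definition computable_omega_1 :: "(baire \<rightharpoonup> baire) \<Rightarrow> bool" where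
  "computable_omega_1 \<Gamma> \<longleftrightarrow> (\<forall>g\<in>dom \<Gamma>. turing_le (the (\<Gamma> g)) g)"


section \<open>Degree structures\<close>

definition reducible :: "((baire \<rightharpoonup> baire) \<Rightarrow> bool) \<Rightarrow> baire set \<Rightarrow> baire set \<Rightarrow> bool" where
  "reducible C A B \<longleftrightarrow> (\<exists>\<Gamma>. C \<Gamma> \<and> B \<subseteq> dom \<Gamma> \<and> (\<forall>g\<in>B. the (\<Gamma> g) \<in> A))"

definition degrees :: "((baire \<rightharpoonup> baire) \<Rightarrow> bool) \<Rightarrow> baire set set set" where
  "degrees C = UNIV // {(A, B). reducible C A B \<and> reducible C B A}"

definition degree_le :: "((baire \<rightharpoonup> baire) \<Rightarrow> bool) \<Rightarrow> baire set set \<Rightarrow> baire set set \<Rightarrow> bool" where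
  "degree_le C X Y \<longleftrightarrow> (\<exists>A\<in>X. \<exists>B\<in>Y. reducible C A B)"


section \<open>First-order sentences in the language of partial orderings\<close>

datatype fm = Le nat nat | Eq nat nat | Neg fm | Conj fm fm | All nat fm

primrec free_vars :: "fm \<Rightarrow> nat set" where
  "free_vars (Le i j) = {i, j}"
| "free_vars (Eq i j) = {i, j}"
| "free_vars (Neg \<phi>) = free_vars \<phi>"
| "free_vars (Conj \<phi> \<chi>) = free_vars \<phi> \<union> free_vars \<chi>"
| "free_vars (All i \<phi>) = free_vars \<phi> - {i}"

definition sentence :: "fm \<Rightarrow> bool" where
  "sentence \<phi> \<longleftrightarrow> free_vars \<phi> = {}"

primrec sat :: "'a set \<Rightarrow> ('a \<Rightarrow> 'a \<Rightarrow> bool) \<Rightarrow> (nat \<Rightarrow> 'a) \<Rightarrow> fm \<Rightarrow> bool" where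
  "sat U R v (Le i j) \<longleftrightarrow> R (v i) (v j)"
| "sat U R v (Eq i j) \<longleftrightarrow> v i = v j"
| "sat U R v (Neg \<phi>) \<longleftrightarrow> \<not> sat U R v \<phi>"
| "sat U R v (Conj \<phi> \<chi>) \<longleftrightarrow> sat U R v \<phi> \<and> sat U R v \<chi>"
| "sat U R v (All i \<phi>) \<longleftrightarrow> (\<forall>x\<in>U. sat U R (v(i := x)) \<phi>)"

definition true_in :: "'a set \<Rightarrow> ('a \<Rightarrow> 'a \<Rightarrow> bool) \<Rightarrow> fm \<Rightarrow> bool" where
  "true_in U R \<phi> \<longleftrightarrow> (\<forall>v. range v \<subseteq> U \<longrightarrow> sat U R v \<phi>)"

end

theory Submission
  imports Defs
begin

text \<open>
  The distinguishing sentence says that the degrees form a Brouwer algebra: for all \<open>a\<close>, \<open>b\<close> there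
  is a least \<open>c\<close> with \<open>b \<le> a \<squnion> c\<close>.

  For the three structures where it holds, an element of the least solution \<open>C\<close> carries the reduction
  (an index or the table of a learner) that it uses, so that a single universal reduction works for all
  of \<open>C\<close>.

  In the other four structures every reduction has a finite bound, and \<open>A\<close> and \<open>B\<close> are chosen such
  that \<open>B\<close> reduces to \<open>A \<otimes> {f m}\<close> with a bound depending on \<open>m\<close>, but for no \<open>h \<le> f m\<close> with a
  smaller bound. If \<open>C\<close> were a least solution, then \<open>B\<close> would reduce to \<open>A \<otimes> C\<close> with some bound, and \<open>C\<close>
  would contain some \<open>h \<le> f m\<close> for every \<open>m\<close>, which is contradictory for large \<open>m\<close>. The elements of
  \<open>A\<close> and the \<open>f m\<close> come from a Turing independent family. Hence on the element \<open>g\<close> of \<open>A\<close> the only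
  useful output is \<open>g \<oplus> f m\<close> labelled with the right number \<open>j \<le> m\<close>. If the bound is on the number
  of learners, this \<open>j\<close> is a number that none of them outputs on \<open>g\<close>. If the bound is on the mind changes or
  hypotheses of one learner, \<open>j\<close> is the limit of a slowly increasing sequence contained in \<open>g\<close>, which
  jumps each time the learner has committed itself.
\<close>

section \<open>Oracle computability: closure rules, codings, a universal machine and a calculus of
  indices\<close>

section \<open>Recursive functionals\<close>

text \<open>The programs meant here are total on every oracle, so the closure rules carry no
  convergence conditions and \<open>recursive_intros\<close> works by backward chaining. Partial
  behaviour enters only through indices and \<open>Phi\<close>.\<close>

definition recursive :: "(baire \<Rightarrow> nat \<Rightarrow> nat) \<Rightarrow> bool" where
  "recursive F \<longleftrightarrow> (\<exists>p. \<forall>g x. evals g p x (F g x))"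

abbreviation pfst :: "nat \<Rightarrow> nat" where "pfst x \<equiv> fst (prod_decode x)"
abbreviation psnd :: "nat \<Rightarrow> nat" where "psnd x \<equiv> snd (prod_decode x)"
abbreviation pair :: "nat \<Rightarrow> nat \<Rightarrow> nat" where "pair x y \<equiv> prod_encode (x, y)"

named_theorems recursive_intros

lemma recursive_comp:
  assumes "recursive F" "recursive H"
  shows "recursive (\<lambda>g x. F g (H g x))"
  using assms unfolding recursive_def by (meson evals.Comp)

lemma recursive_id [recursive_intros]: "recursive (\<lambda>g x. x)"
proof -
  have "evals g (Tuple Left Right) x x" for g x
    using evals.Tuple[OF evals.Left evals.Right, of g x] by simp
  then show ?thesis unfolding recursive_def by blast
qed

lemma recursive_Suc [recursive_intros]:
  assumes "recursive F" shows "recursive (\<lambda>g x. Suc (F g x))"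
proof -
  have "recursive (\<lambda>g x. Suc x)" unfolding recursive_def by (meson evals.Succ)
  from recursive_comp[OF this assms] show ?thesis .
qed

lemma recursive_fst [recursive_intros]:
  assumes "recursive F" shows "recursive (\<lambda>g x. pfst (F g x))"
proof -
  have "recursive (\<lambda>g x. pfst x)" unfolding recursive_def by (meson evals.Left)
  from recursive_comp[OF this assms] show ?thesis .
qed

lemma recursive_snd [recursive_intros]:
  assumes "recursive F" shows "recursive (\<lambda>g x. psnd (F g x))"
proof -
  have "recursive (\<lambda>g x. psnd x)" unfolding recursive_def by (meson evals.Right)
  from recursive_comp[OF this assms] show ?thesis .
qed

lemma recursive_query [recursive_intros]:
  assumes "recursive F" shows "recursive (\<lambda>g x. g (F g x))"
proof -
  have "recursive (\<lambda>g x. g x)" unfolding recursive_def by (meson evals.Oracle)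
  from recursive_comp[OF this assms] show ?thesis .
qed

lemma recursive_const [recursive_intros]: "recursive (\<lambda>g x. c)"
proof (induction c)
  case 0
  show ?case unfolding recursive_def by (meson evals.Zero)
next
  case (Suc c)
  then show ?case by (rule recursive_Suc)
qed

lemma recursive_pair [recursive_intros]:
  assumes "recursive F" "recursive H"
  shows "recursive (\<lambda>g x. pair (F g x) (H g x))"
  using assms unfolding recursive_def by (meson evals.Tuple)

text \<open>\<open>PrimRec\<close> carries one parameter. Taking the whole input \<open>x\<close>
  for it lets the step function depend on \<open>x\<close>; the step is then computed from the coded
  triple of parameter, counter and previous value.\<close>

lemma recursive_rec_nat [recursive_intros]:
  assumes A: "recursive A"
    and H: "recursive (\<lambda>g z. H g (pfst z) (pfst (psnd z)) (psnd (psnd z)))"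
    and N: "recursive N"
  shows "recursive (\<lambda>g x. rec_nat (A g x) (H g x) (N g x))"
proof -
  obtain pA where pA: "\<And>g x. evals g pA x (A g x)" using A unfolding recursive_def by blast
  obtain pH where pH: "\<And>g z. evals g pH z (H g (pfst z) (pfst (psnd z)) (psnd (psnd z)))"
    using H unfolding recursive_def by blast
  have "evals g (PrimRec pA pH) (pair x n) (rec_nat (A g x) (H g x) n)" for g x n
  proof (induction n)
    case 0
    show ?case using evals.PrimRec_0[OF pA] by simp
  next
    case (Suc n)
    show ?case
      using evals.PrimRec_Suc[OF Suc, of "H g x n (rec_nat (A g x) (H g x) n)"]
        pH[of g "pair x (pair n (rec_nat (A g x) (H g x) n))"] by simp
  qed
  then have "evals g (PrimRec pA pH) z (rec_nat (A g (pfst z)) (H g (pfst z)) (psnd z))" for g z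
    by (metis prod.collapse prod_decode_inverse)
  then have "recursive (\<lambda>g z. rec_nat (A g (pfst z)) (H g (pfst z)) (psnd z))"
    unfolding recursive_def by blast
  from recursive_comp[OF this recursive_pair[OF recursive_id N]] show ?thesis by simp
qed

lemma recursive_if0 [recursive_intros]:
  assumes "recursive C" "recursive A" "recursive B"
  shows "recursive (\<lambda>g x. if C g x = 0 then A g x else B g x)"
proof -
  \<comment> \<open>Inside the recursion the original input is a projection of the coded triple, so
    \<open>B\<close> has to be composed with that projection.\<close>
  have "recursive (\<lambda>g x. rec_nat (A g x) (\<lambda>_ _. B g x) (C g x))"
    by (intro recursive_intros assms recursive_comp[OF assms(3)])
  moreover have "rec_nat (A g x) (\<lambda>_ _. B g x) (C g x) = (if C g x = 0 then A g x else B g x)" for g x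
    by (cases "C g x") auto
  ultimately show ?thesis by simp
qed

lemma recursive_pred [recursive_intros]:
  assumes "recursive F" shows "recursive (\<lambda>g x. F g x - 1)"
proof -
  have "recursive (\<lambda>g x. rec_nat 0 (\<lambda>n _. n) (F g x))"
    by (intro recursive_intros assms)
  moreover have "rec_nat 0 (\<lambda>n _. n) m = m - 1" for m :: nat by (cases m) auto
  ultimately show ?thesis by simp
qed

lemma recursive_add [recursive_intros]:
  assumes "recursive F" "recursive H" shows "recursive (\<lambda>g x. F g x + H g x)"
proof -
  have "recursive (\<lambda>g x. rec_nat (F g x) (\<lambda>_ y. Suc y) (H g x))"
    by (intro recursive_intros assms)
  moreover have "rec_nat a (\<lambda>_ y. Suc y) b = a + b" for a b :: nat by (induction b) auto
  ultimately show ?thesis by simp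
qed

lemma recursive_diff [recursive_intros]:
  assumes "recursive F" "recursive H" shows "recursive (\<lambda>g x. F g x - H g x)"
proof -
  have "recursive (\<lambda>g x. rec_nat (F g x) (\<lambda>_ y. y - 1) (H g x))"
    by (intro recursive_intros assms)
  moreover have "rec_nat a (\<lambda>_ y. y - 1) b = a - b" for a b :: nat by (induction b) auto
  ultimately show ?thesis by simp
qed

lemma recursive_mult [recursive_intros]:
  assumes "recursive F" "recursive H" shows "recursive (\<lambda>g x. F g x * H g x)"
proof -
  have "recursive (\<lambda>g x. rec_nat 0 (\<lambda>_ y. y + F g x) (H g x))"
    by (intro recursive_intros assms recursive_comp[OF assms(1)])
  moreover have "rec_nat 0 (\<lambda>_ y. y + a) b = a * b" for a b :: nat by (induction b) auto
  ultimately show ?thesis by simp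
qed

definition decidable :: "(baire \<Rightarrow> nat \<Rightarrow> bool) \<Rightarrow> bool" where
  "decidable P \<longleftrightarrow> recursive (\<lambda>g x. of_bool (P g x))"

lemma recursive_if [recursive_intros]:
  assumes "decidable P" "recursive A" "recursive B"
  shows "recursive (\<lambda>g x. if P g x then A g x else B g x)"
  using recursive_if0[OF assms(1)[unfolded decidable_def] assms(3,2)]
  by (rule back_subst[where P = recursive]) (auto simp: fun_eq_iff)

lemma decidable_eq0:
  assumes "recursive F" shows "decidable (\<lambda>g x. F g x = 0)"
  using recursive_if0[OF assms recursive_const[of 1] recursive_const[of 0]]
  unfolding decidable_def by (rule back_subst[where P = recursive]) (auto simp: fun_eq_iff)

lemma decidable_not [recursive_intros]:
  assumes "decidable P" shows "decidable (\<lambda>g x. \<not> P g x)"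
  using decidable_eq0[OF assms[unfolded decidable_def]] by simp

lemma decidable_conj [recursive_intros]:
  assumes "decidable P" "decidable Q" shows "decidable (\<lambda>g x. P g x \<and> Q g x)"
  using recursive_mult[OF assms[unfolded decidable_def]]
  unfolding decidable_def by (rule back_subst[where P = recursive]) (auto simp: fun_eq_iff)

lemma decidable_le [recursive_intros]:
  assumes "recursive F" "recursive H" shows "decidable (\<lambda>g x. F g x \<le> H g x)"
  using decidable_eq0[OF recursive_diff[OF assms]] by simp

lemma decidable_less [recursive_intros]:
  assumes "recursive F" "recursive H" shows "decidable (\<lambda>g x. F g x < H g x)"
  using decidable_not[OF decidable_le[OF assms(2,1)]] by (simp add: not_le)

lemma decidable_eq [recursive_intros]:
  assumes "recursive F" "recursive H" shows "decidable (\<lambda>g x. F g x = H g x)"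
  using decidable_conj[OF decidable_le[OF assms] decidable_le[OF assms(2,1)]]
  by (rule back_subst[where P = decidable]) (auto simp: fun_eq_iff)

text \<open>These two operations decode the constructor and the arguments of a program number in
  \<open>prog_of\<close>. Both are obtained by counting up to the number.\<close>

lemma recursive_div4_mod4:
  assumes "recursive F"
  shows "recursive (\<lambda>g x. F g x div 4)" "recursive (\<lambda>g x. F g x mod 4)"
proof -
  have mod: "rec_nat 0 (\<lambda>_ y. if y = 3 then 0 else Suc y) m = m mod 4" for m :: nat
    by (induction m) (auto simp: mod_Suc)
  have mod4: "recursive (\<lambda>g x. F g x mod 4)" if "recursive F" for F
    by (subst mod[symmetric]) (intro recursive_intros that)
  from assms show "recursive (\<lambda>g x. F g x mod 4)" by (rule mod4)
  have div: "rec_nat 0 (\<lambda>n y. if n mod 4 = 3 then Suc y else y) m = m div 4" for m :: nat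
    by (induction m) (auto simp: div_Suc mod_Suc)
  have "recursive (\<lambda>g x. rec_nat 0 (\<lambda>n y. if n mod 4 = 3 then Suc y else y) (F g x))"
    by (intro recursive_intros assms mod4)
  then show "recursive (\<lambda>g x. F g x div 4)" by (simp add: div)
qed

lemmas [recursive_intros] = recursive_div4_mod4

lemma recursive_min [recursive_intros]:
  assumes "recursive F" "recursive H" shows "recursive (\<lambda>g x. min (F g x) (H g x))"
  unfolding min_def by (intro recursive_intros assms)


section \<open>Coded lists\<close>

text \<open>\<open>list_encode\<close> maps a nonempty list to the successor of a pair of head and
  coded tail. At 0 truncated subtraction and \<open>prod_decode 0 = (0, 0)\<close> return the empty
  list again.\<close>

definition tl_code :: "nat \<Rightarrow> nat" where "tl_code c = psnd (c - 1)"

text \<open>Entries are shifted by one so that 0 can signal a position beyond the end. This is the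
  format in which the universal machine queries a finite oracle.\<close>

definition lookup :: "nat \<Rightarrow> nat \<Rightarrow> nat" where
  "lookup c i = (let d = rec_nat c (\<lambda>_. tl_code) i in if d = 0 then 0 else Suc (pfst (d - 1)))"

lemma recursive_lookup [recursive_intros]:
  assumes "recursive F" "recursive H" shows "recursive (\<lambda>g x. lookup (F g x) (H g x))"
  unfolding lookup_def tl_code_def Let_def by (intro recursive_intros assms)

lemma prod_decode_0: "prod_decode 0 = (0, 0)"
  using prod_encode_inverse[of "(0, 0)"] by (simp add: prod_encode_def)

lemma tl_code_list_encode: "tl_code (list_encode xs) = list_encode (tl xs)"
  by (cases xs) (simp_all add: tl_code_def prod_decode_0)

lemma lookup_list_encode: "lookup (list_encode xs) i = (if i < length xs then Suc (xs ! i) else 0)"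
proof -
  have "rec_nat (list_encode xs) (\<lambda>_. tl_code) i = list_encode (drop i xs)"
    by (induction i) (auto simp: tl_code_list_encode drop_Suc tl_drop)
  then show ?thesis
    using Cons_nth_drop_Suc[of i xs, symmetric] by (cases "i < length xs") (simp_all add: lookup_def)
qed

text \<open>A list is never longer than its code, so it suffices to look at the positions below
  \<open>c\<close> and to remember the last occupied one.\<close>

definition len_code :: "nat \<Rightarrow> nat" where
  "len_code c = rec_nat 0 (\<lambda>k y. if lookup c k \<noteq> 0 then Suc k else y) c"

lemma length_le_list_encode: "length xs \<le> list_encode xs"
proof (induction xs)
  case (Cons x xs)
  then show ?case using le_prod_encode_2[of "list_encode xs" x] by simp
qed simp

lemma len_code_list_encode: "len_code (list_encode xs) = length xs"
proof -
  have "rec_nat 0 (\<lambda>k y. if lookup (list_encode xs) k \<noteq> 0 then Suc k else y) n = min n (length xs)" for n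
    by (induction n) (auto simp: lookup_list_encode)
  then show ?thesis using length_le_list_encode[of xs] by (simp add: len_code_def)
qed

lemma recursive_length [recursive_intros]:
  assumes "recursive (\<lambda>g x. list_encode (S g x))" shows "recursive (\<lambda>g x. length (S g x))"
proof -
  have "recursive (\<lambda>g x. len_code (F g x))" if "recursive F" for F
    unfolding len_code_def by (intro recursive_intros that recursive_comp[OF that])
  from this[OF assms] show ?thesis by (simp add: len_code_list_encode)
qed

lemma recursive_map_upt [recursive_intros]:
  assumes F: "recursive (\<lambda>g z. F g (pfst z) (psnd z))" and N: "recursive N"
  shows "recursive (\<lambda>g x. list_encode (map (F g x) [0..<N g x]))"
proof -
  \<comment> \<open>The head is outermost in a list code, so the list is built from its right end:
    \<open>k\<close> steps cover the last \<open>k\<close> positions.\<close>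
  have "rec_nat 0 (\<lambda>k y. Suc (pair (F g x (n - Suc k)) y)) k = list_encode (map (F g x) [n - k..<n])"
    if "k \<le> n" for g x n k
    using that
  proof (induction k)
    case (Suc k)
    then have "[n - Suc k..<n] = (n - Suc k) # [n - k..<n]"
      by (subst upt_rec) (auto simp: Suc_diff_Suc)
    with Suc show ?case by simp
  qed simp
  then have eq: "rec_nat 0 (\<lambda>k y. Suc (pair (F g x (N g x - Suc k)) y)) (N g x)
      = list_encode (map (F g x) [0..<N g x])" for g x
    by simp
  have F': "recursive (\<lambda>g x. F g (A g x) (B g x))" if "recursive A" "recursive B" for A B
    using recursive_comp[OF F recursive_pair[OF that]] by simp
  have "recursive (\<lambda>g x. rec_nat 0 (\<lambda>k y. Suc (pair (F g x (N g x - Suc k)) y)) (N g x))"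
    by (intro recursive_intros F' N recursive_comp[OF N])
  then show ?thesis by (simp add: eq)
qed

lemma recursive_list_decode [recursive_intros]:
  "recursive F \<Longrightarrow> recursive (\<lambda>g x. list_encode (list_decode (F g x)))"
  by simp

lemma recursive_restr [recursive_intros]:
  "recursive N \<Longrightarrow> recursive (\<lambda>g x. list_encode (restr g (N g x)))"
  unfolding restr_def by (intro recursive_intros)

lemma recursive_take [recursive_intros]:
  assumes S: "recursive (\<lambda>g x. list_encode (S g x))" and N: "recursive N"
  shows "recursive (\<lambda>g x. list_encode (take (N g x) (S g x)))"
proof -
  have eq: "map (\<lambda>i. lookup (list_encode xs) i - 1) [0..<min n (length xs)] = take n xs" for xs n
    by (rule nth_equalityI) (auto simp: lookup_list_encode)
  have "recursive (\<lambda>g x. list_encode (map (\<lambda>i. lookup (list_encode (S g x)) i - 1)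
      [0..<min (N g x) (length (S g x))]))"
    by (intro recursive_intros S N recursive_comp[OF S])
  then show ?thesis by (simp only: eq)
qed

lemma length_restr [simp]: "length (restr g n) = n"
  by (simp add: restr_def)

lemma nth_restr [simp]: "i < n \<Longrightarrow> restr g n ! i = g i"
  by (simp add: restr_def)

lemma take_restr: "m \<le> n \<Longrightarrow> take m (restr g n) = restr g m"
  by (rule nth_equalityI) auto

lemma restr_cong: "(\<And>i. i < n \<Longrightarrow> g i = h i) \<Longrightarrow> restr g n = restr h n"
  by (simp add: restr_def)


section \<open>Learners as recursive functions\<close>

text \<open>Learners run on the zero oracle, whose answers \<open>Zero\<close> gives as well. The
  resulting program ignores its oracle, which puts learners under the closure rules for
  \<open>recursive\<close>.\<close>

primrec deoracle :: "prog \<Rightarrow> prog" where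
  "deoracle Zero = Zero"
| "deoracle Succ = Succ"
| "deoracle Left = Left"
| "deoracle Right = Right"
| "deoracle Oracle = Zero"
| "deoracle (Tuple p q) = Tuple (deoracle p) (deoracle q)"
| "deoracle (Comp p q) = Comp (deoracle p) (deoracle q)"
| "deoracle (PrimRec p q) = PrimRec (deoracle p) (deoracle q)"
| "deoracle (Minim p) = Minim (deoracle p)"

lemma evals_deoracle: "evals (\<lambda>_. 0) p x y \<Longrightarrow> evals g (deoracle p) x y"
proof (induction rule: evals.induct)
  case (Minim p a n)
  then show ?case by (auto intro!: evals.Minim)
qed (auto intro: evals.intros)

lemma Phi_eq_Some_iff: "Phi e g = Some f \<longleftrightarrow> (\<forall>x. evals g (prog_of e) x (f x))"
proof
  assume "Phi e g = Some f"
  then show "\<forall>x. evals g (prog_of e) x (f x)"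
    unfolding Phi_def by (auto split: if_splits) (metis evals_deterministic theI)
next
  assume *: "\<forall>x. evals g (prog_of e) x (f x)"
  then have "(THE y. evals g (prog_of e) x y) = f x" for x
    by (intro the_equality) (auto intro: evals_deterministic)
  with * show "Phi e g = Some f" unfolding Phi_def by auto
qed

lemma learner_iff: "learner \<psi> \<longleftrightarrow> recursive (\<lambda>_ c. \<psi> (list_decode c))"
proof
  assume "learner \<psi>"
  then obtain e h where e: "Phi e (\<lambda>_. 0) = Some h" and \<psi>: "\<psi> = (\<lambda>\<sigma>. h (list_encode \<sigma>))"
    unfolding learner_def Psi_def by auto
  have "evals g (deoracle (prog_of e)) x (h x)" for g x
    using e by (intro evals_deoracle) (simp add: Phi_eq_Some_iff)
  then have "recursive (\<lambda>_. h)" unfolding recursive_def by blast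
  then show "recursive (\<lambda>_ c. \<psi> (list_decode c))" by (simp add: \<psi>)
next
  assume "recursive (\<lambda>_ c. \<psi> (list_decode c))"
  then obtain p where p: "\<And>g c. evals g p c (\<psi> (list_decode c))" unfolding recursive_def by blast
  obtain e where e: "prog_of e = p" using surj_prog_of by (metis surjD)
  have "Phi e (\<lambda>_. 0) = Some (\<lambda>c. \<psi> (list_decode c))"
    using p by (simp add: Phi_eq_Some_iff e)
  then have "Psi e = Some \<psi>" by (simp add: Psi_def)
  then show "learner \<psi>" unfolding learner_def by blast
qed

lemma recursive_learner:
  assumes "learner \<psi>" "recursive (\<lambda>g x. list_encode (S g x))"
  shows "recursive (\<lambda>g x. \<psi> (S g x))"
  using recursive_comp[OF assms(1)[unfolded learner_iff] assms(2)] by simp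

lemma recursive_imp_Phi:
  assumes "recursive F" shows "\<exists>e. \<forall>g. Phi e g = Some (F g)"
proof -
  from assms obtain p where "\<And>g x. evals g p x (F g x)" unfolding recursive_def by blast
  moreover obtain e where "prog_of e = p" using surj_prog_of by (metis surjD)
  ultimately show ?thesis by (auto simp: Phi_eq_Some_iff)
qed


section \<open>A universal machine with finite oracle information\<close>

text \<open>
  A state \<open>(Suc e, x, k)\<close> evaluates program number \<open>e\<close> at \<open>x\<close> and a state \<open>(0, v, k)\<close> returns
  the value \<open>v\<close>, in both cases with the stack coded by \<open>k\<close>. The oracle is a function \<open>q\<close> where
  \<open>q i = Suc v\<close> is the answer \<open>v\<close> and \<open>q i = 0\<close> means that the answer is not known; in this case
  the machine is stuck.
\<close>

definition push :: "nat \<Rightarrow> nat \<Rightarrow> nat \<Rightarrow> nat \<Rightarrow> nat" where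
  "push t a b k = Suc (pair (pair t (pair a b)) k)"

text \<open>The tag of the top frame says what waits for the value \<open>v\<close>: 0 is a pair
  whose second component is still to be computed, 4 a pair whose first component is stored, 1 the
  outer program of a composition, 2 the step of a primitive recursion and 3 a minimisation.\<close>

definition return_step :: "nat \<Rightarrow> nat \<Rightarrow> nat \<Rightarrow> nat \<times> nat \<times> nat" where
  "return_step v f k =
    (let t = pfst f; a = pfst (psnd f); b = psnd (psnd f) in
      if t = 0 then (Suc a, b, push 4 v 0 k)
      else if t = 1 then (Suc a, v, k)
      else if t = 2 then (Suc a, pair (pfst b) (pair (psnd b) v), k)
      else if t = 3 then
        (if v = 0 then (0, psnd b, k)
         else (Suc a, pair (pfst b) (Suc (psnd b)), push 3 a (pair (pfst b) (Suc (psnd b))) k))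
      else (0, pair a v, k))"

definition eval_step :: "(nat \<Rightarrow> nat) \<Rightarrow> nat \<Rightarrow> nat \<Rightarrow> nat \<Rightarrow> nat \<times> nat \<times> nat" where
  "eval_step q e x k =
    (if e = 0 then (0, 0, k) else if e = 1 then (0, Suc x, k)
     else if e = 2 then (0, pfst x, k) else if e = 3 then (0, psnd x, k)
     else if e = 4 then (if q x = 0 then (Suc e, x, k) else (0, q x - 1, k))
     else let d = (e - 5) div 4; m = (e - 5) mod 4; a = pfst d; b = psnd d in
       if m = 0 then (Suc a, x, push 0 b x k)
       else if m = 1 then (Suc b, x, push 1 a 0 k)
       else if m = 2 then
         (if psnd x = 0 then (Suc a, pfst x, k)
          else (Suc e, pair (pfst x) (psnd x - 1), push 2 b (pair (pfst x) (psnd x - 1)) k))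
       else (Suc d, pair x 0, push 3 d (pair x 0) k))"

definition step :: "(nat \<Rightarrow> nat) \<Rightarrow> nat \<times> nat \<times> nat \<Rightarrow> nat \<times> nat \<times> nat" where
  "step q = (\<lambda>(c, v, k).
    if c = 0 then if k = 0 then (0, v, 0) else return_step v (pfst (k - 1)) (psnd (k - 1))
    else eval_step q (c - 1) v k)"

text \<open>With a list code as oracle and a step bound this is a total recursive function. A result
  is shifted by one, so 0 means that no result has been reached.\<close>

definition run :: "nat \<Rightarrow> nat \<Rightarrow> nat \<Rightarrow> nat \<Rightarrow> nat" where
  "run e c x t = (case (step (lookup c) ^^ t) (Suc e, x, 0) of
    (c, v, k) \<Rightarrow> if c = 0 \<and> k = 0 then Suc v else 0)"

lemma recursive_run [recursive_intros]:
  assumes "recursive E" "recursive C" "recursive X" "recursive T"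
  shows "recursive (\<lambda>g x. run (E g x) (C g x) (X g x) (T g x))"
proof -
  define enc :: "nat \<times> nat \<times> nat \<Rightarrow> nat" where "enc = (\<lambda>(c, v, k). pair c (pair v k))"
  define dec :: "nat \<Rightarrow> nat \<times> nat \<times> nat" where
    "dec s = (pfst s, pfst (psnd s), psnd (psnd s))" for s
  have dec_enc: "dec (enc s) = s" for s by (cases s) (simp add: enc_def dec_def)
  have enc_if: "enc (if P then s else s') = (if P then enc s else enc s')" for P s s' by simp
  have enc_triple: "enc (c, v, k) = pair c (pair v k)" for c v k by (simp add: enc_def)
  have "rec_nat (enc s) (\<lambda>_ y. enc (step q (dec y))) t = enc ((step q ^^ t) s)" for q s t
    by (induction t) (auto simp: dec_enc)
  then have iter: "(step q ^^ t) s = dec (rec_nat (enc s) (\<lambda>_ y. enc (step q (dec y))) t)" for q s t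
    by (metis dec_enc)
  have step': "recursive (\<lambda>g x. enc (step (lookup (F g x)) (dec (H g x))))"
    if "recursive F" "recursive H" for F H
    unfolding step_def dec_def prod.case return_step_def eval_step_def Let_def enc_if enc_triple push_def
    by (intro recursive_intros that)
  have run: "run e c x t = (let s = rec_nat (pair (Suc e) (pair x 0)) (\<lambda>_ y. enc (step (lookup c) (dec y))) t
      in if pfst s = 0 \<and> psnd (psnd s) = 0 then Suc (pfst (psnd s)) else 0)" for e c x t
    unfolding run_def iter enc_triple by (simp only: dec_def Let_def prod.case)
  show ?thesis
    unfolding run Let_def
    by (intro recursive_intros step' assms recursive_comp[OF assms(2)])
qed

definition reach :: "(nat \<Rightarrow> nat) \<Rightarrow> nat \<times> nat \<times> nat \<Rightarrow> nat \<times> nat \<times> nat \<Rightarrow> bool" where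
  "reach q s s' \<longleftrightarrow> (\<exists>n. (step q ^^ n) s = s')"

lemma reach_refl: "reach q s s"
  unfolding reach_def by (rule exI[of _ 0]) simp

lemma reach_trans: "reach q s s' \<Longrightarrow> reach q s' s'' \<Longrightarrow> reach q s s''"
  unfolding reach_def by (metis comp_apply funpow_add)

lemma reach_step: "step q s = s' \<Longrightarrow> reach q s' s'' \<Longrightarrow> reach q s s''"
  by (rule reach_trans[of q s s']) (auto simp: reach_def intro!: exI[of _ "Suc 0"])

lemma step_return [simp]:
  "step q (0, v, push 0 b x k) = (Suc b, x, push 4 v 0 k)"
  "step q (0, v, push 4 a 0 k) = (0, pair a v, k)"
  "step q (0, v, push 1 a 0 k) = (Suc a, v, k)"
  "step q (0, v, push 2 b (pair x n) k) = (Suc b, pair x (pair n v), k)"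
  "step q (0, 0, push 3 d (pair x n) k) = (0, n, k)"
  "step q (0, Suc v, push 3 d (pair x n) k) = (Suc d, pair x (Suc n), push 3 d (pair x (Suc n)) k)"
  by (simp_all add: step_def return_step_def push_def)

lemma prog_of_cases:
  "prog_of e = Zero \<Longrightarrow> e = 0" "prog_of e = Succ \<Longrightarrow> e = 1"
  "prog_of e = Left \<Longrightarrow> e = 2" "prog_of e = Right \<Longrightarrow> e = 3" "prog_of e = Oracle \<Longrightarrow> e = 4"
  by (subst (asm) prog_of.simps, simp add: Let_def split: if_splits)+

lemma step_Tuple:
  assumes "prog_of e = Tuple p p'"
  obtains a b where "prog_of a = p" "prog_of b = p'"
    "\<And>q x k. step q (Suc e, x, k) = (Suc a, x, push 0 b x k)"
  using assms
  by (subst (asm) prog_of.simps) (auto simp: Let_def step_def eval_step_def split: if_splits)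

lemma step_Comp:
  assumes "prog_of e = Comp p p'"
  obtains a b where "prog_of a = p" "prog_of b = p'"
    "\<And>q x k. step q (Suc e, x, k) = (Suc b, x, push 1 a 0 k)"
  using assms
  by (subst (asm) prog_of.simps) (auto simp: Let_def step_def eval_step_def split: if_splits)

lemma step_PrimRec:
  assumes "prog_of e = PrimRec p p'"
  obtains a b where "prog_of a = p" "prog_of b = p'"
    "\<And>q x k. step q (Suc e, pair x 0, k) = (Suc a, x, k)"
    "\<And>q x n k. step q (Suc e, pair x (Suc n), k) = (Suc e, pair x n, push 2 b (pair x n) k)"
  using assms
  by (subst (asm) prog_of.simps) (auto simp: Let_def step_def eval_step_def split: if_splits)

lemma step_Minim:
  assumes "prog_of e = Minim p"
  obtains d where "prog_of d = p"
    "\<And>q x k. step q (Suc e, x, k) = (Suc d, pair x 0, push 3 d (pair x 0) k)"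
proof -
  have "(e - 5) mod 4 < 4" by simp
  with assms show thesis
    by (intro that[of "(e - 5) div 4"]; subst (asm) prog_of.simps)
      (auto simp: Let_def step_def eval_step_def split: if_splits)
qed

text \<open>A halting computation consults only a finite part of the oracle, and \<open>N\<close>
  bounds that part. The stack is arbitrary because subcomputations run on top of the frames of the
  surrounding computation.\<close>

lemma evals_imp_reach:
  "evals g p x y \<Longrightarrow> prog_of e = p \<Longrightarrow>
    \<exists>N. \<forall>q. (\<forall>i<N. q i = Suc (g i)) \<longrightarrow> (\<forall>k. reach q (Suc e, x, k) (0, y, k))"
proof (induction arbitrary: e rule: evals.induct)
  case (Zero x)
  have "step q (Suc e, x, k) = (0, 0, k)" for q k
    using prog_of_cases(1)[OF Zero] by (simp add: step_def eval_step_def)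
  from reach_step[OF this reach_refl] show ?case by blast
next
  case (Succ x)
  have "step q (Suc e, x, k) = (0, Suc x, k)" for q k
    using prog_of_cases(2)[OF Succ] by (simp add: step_def eval_step_def)
  from reach_step[OF this reach_refl] show ?case by blast
next
  case (Left x)
  have "step q (Suc e, x, k) = (0, pfst x, k)" for q k
    using prog_of_cases(3)[OF Left] by (simp add: step_def eval_step_def)
  from reach_step[OF this reach_refl] show ?case by blast
next
  case (Right x)
  have "step q (Suc e, x, k) = (0, psnd x, k)" for q k
    using prog_of_cases(4)[OF Right] by (simp add: step_def eval_step_def)
  from reach_step[OF this reach_refl] show ?case by blast
next
  case (Oracle x)
  have "step q (Suc e, x, k) = (0, g x, k)" if "q x = Suc (g x)" for q k
    using prog_of_cases(5)[OF Oracle] that by (simp add: step_def eval_step_def)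
  then show ?case by (auto intro!: exI[of _ "Suc x"] intro: reach_step reach_refl)
next
  case (Tuple p x y p' z)
  from step_Tuple[OF Tuple.prems] obtain a b where ab: "prog_of a = p" "prog_of b = p'"
    "\<And>q x k. step q (Suc e, x, k) = (Suc a, x, push 0 b x k)" by metis
  from Tuple.IH(1)[OF ab(1)] obtain N where
    N: "\<And>q k. \<forall>i<N. q i = Suc (g i) \<Longrightarrow> reach q (Suc a, x, k) (0, y, k)" by blast
  from Tuple.IH(2)[OF ab(2)] obtain M where
    M: "\<And>q k. \<forall>i<M. q i = Suc (g i) \<Longrightarrow> reach q (Suc b, x, k) (0, z, k)" by blast
  have "reach q (Suc e, x, k) (0, pair y z, k)" if "\<forall>i<max N M. q i = Suc (g i)" for q k
  proof -
    have "reach q (Suc e, x, k) (0, y, push 0 b x k)"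
      using that by (intro reach_step[OF ab(3)] N) auto
    moreover have "reach q (0, y, push 0 b x k) (0, z, push 4 y 0 k)"
      using that by (intro reach_step[OF step_return(1)] M) auto
    moreover have "reach q (0, z, push 4 y 0 k) (0, pair y z, k)"
      by (intro reach_step[OF step_return(2)] reach_refl)
    ultimately show ?thesis by (metis reach_trans)
  qed
  then show ?case by blast
next
  case (Comp p' x y p z)
  from step_Comp[OF Comp.prems] obtain a b where ab: "prog_of a = p" "prog_of b = p'"
    "\<And>q x k. step q (Suc e, x, k) = (Suc b, x, push 1 a 0 k)" by metis
  from Comp.IH(1)[OF ab(2)] obtain N where
    N: "\<And>q k. \<forall>i<N. q i = Suc (g i) \<Longrightarrow> reach q (Suc b, x, k) (0, y, k)" by blast
  from Comp.IH(2)[OF ab(1)] obtain M where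
    M: "\<And>q k. \<forall>i<M. q i = Suc (g i) \<Longrightarrow> reach q (Suc a, y, k) (0, z, k)" by blast
  have "reach q (Suc e, x, k) (0, z, k)" if "\<forall>i<max N M. q i = Suc (g i)" for q k
  proof -
    have "reach q (Suc e, x, k) (0, y, push 1 a 0 k)"
      using that by (intro reach_step[OF ab(3)] N) auto
    moreover have "reach q (0, y, push 1 a 0 k) (0, z, k)"
      using that by (intro reach_step[OF step_return(3)] M) auto
    ultimately show ?thesis by (metis reach_trans)
  qed
  then show ?case by blast
next
  case (PrimRec_0 p x y p')
  from step_PrimRec[OF PrimRec_0.prems] obtain a where ab: "prog_of a = p"
    "\<And>q x k. step q (Suc e, pair x 0, k) = (Suc a, x, k)" by metis
  from PrimRec_0.IH[OF ab(1)] show ?case using reach_step[OF ab(2)] by blast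
next
  case (PrimRec_Suc p p' x n y z)
  from step_PrimRec[OF PrimRec_Suc.prems] obtain b where ab: "prog_of b = p'"
    "\<And>q x n k. step q (Suc e, pair x (Suc n), k) = (Suc e, pair x n, push 2 b (pair x n) k)" by metis
  from PrimRec_Suc.IH(1)[OF PrimRec_Suc.prems] obtain N where
    N: "\<And>q k. \<forall>i<N. q i = Suc (g i) \<Longrightarrow> reach q (Suc e, pair x n, k) (0, y, k)" by blast
  from PrimRec_Suc.IH(2)[OF ab(1)] obtain M where
    M: "\<And>q k. \<forall>i<M. q i = Suc (g i) \<Longrightarrow> reach q (Suc b, pair x (pair n y), k) (0, z, k)" by blast
  have "reach q (Suc e, pair x (Suc n), k) (0, z, k)" if "\<forall>i<max N M. q i = Suc (g i)" for q k
  proof -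
    have "reach q (Suc e, pair x (Suc n), k) (0, y, push 2 b (pair x n) k)"
      using that by (intro reach_step[OF ab(2)] N) auto
    moreover have "reach q (0, y, push 2 b (pair x n) k) (0, z, k)"
      using that by (intro reach_step[OF step_return(4)] M) auto
    ultimately show ?thesis by (metis reach_trans)
  qed
  then show ?case by blast
next
  case (Minim p x n)
  from step_Minim[OF Minim.prems] obtain d where d: "prog_of d = p"
    "\<And>q x k. step q (Suc e, x, k) = (Suc d, pair x 0, push 3 d (pair x 0) k)" by metis
  from Minim.IH(1)[OF d(1)] obtain N where
    N: "\<And>q k. \<forall>i<N. q i = Suc (g i) \<Longrightarrow> reach q (Suc d, pair x n, k) (0, 0, k)" by blast
  have "\<exists>M. \<forall>q. (\<forall>i<M. q i = Suc (g i)) \<longrightarrow>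
      (\<forall>k. \<exists>y. reach q (Suc d, pair x m, k) (0, Suc y, k))" if "m < n" for m
  proof -
    from Minim.IH(2) that obtain y where "\<exists>M. \<forall>q. (\<forall>i<M. q i = Suc (g i)) \<longrightarrow>
      (\<forall>k. reach q (Suc d, pair x m, k) (0, Suc y, k))"
      using d(1) by blast
    then show ?thesis by blast
  qed
  then obtain M where M: "\<And>m q k. m < n \<Longrightarrow> \<forall>i<M m. q i = Suc (g i) \<Longrightarrow>
      \<exists>y. reach q (Suc d, pair x m, k) (0, Suc y, k)"
    by metis
  \<comment> \<open>The tests for the finitely many arguments up to \<open>n\<close> have separate
    bounds; their maximum serves all of them.\<close>
  have "reach q (Suc e, x, k) (0, n, k)" if q: "\<forall>i<Max (insert N (M ` {..<n})). q i = Suc (g i)" for q k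
  proof -
    have "N \<le> Max (insert N (M ` {..<n}))" "\<And>m. m < n \<Longrightarrow> M m \<le> Max (insert N (M ` {..<n}))"
      by (auto intro!: Max_ge)
    then have qN: "\<forall>i<N. q i = Suc (g i)" and qM: "\<And>m. m < n \<Longrightarrow> \<forall>i<M m. q i = Suc (g i)"
      using q by (meson order_less_le_trans)+
    have "reach q (Suc e, x, k) (Suc d, pair x m, push 3 d (pair x m) k)" if "m \<le> n" for m
      using that
    proof (induction m)
      case 0
      show ?case by (intro reach_step[OF d(2)] reach_refl)
    next
      case (Suc m)
      then obtain y where y: "reach q (Suc d, pair x m, push 3 d (pair x m) k) (0, Suc y, push 3 d (pair x m) k)"
        using M qM by (meson Suc_le_lessD)
      with Suc show ?case by (meson reach_trans reach_step[OF step_return(6)] reach_refl Suc_leD)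
    qed
    then have "reach q (Suc e, x, k) (Suc d, pair x n, push 3 d (pair x n) k)" by simp
    moreover have "reach q (Suc d, pair x n, push 3 d (pair x n) k) (0, 0, push 3 d (pair x n) k)"
      using qN by (intro N)
    moreover have "reach q (0, 0, push 3 d (pair x n) k) (0, n, k)"
      by (intro reach_step[OF step_return(5)] reach_refl)
    ultimately show ?thesis by (metis reach_trans)
  qed
  then show ?case by blast
qed

text \<open>Additional answers matter only at a query that \<open>q\<close> leaves open. There the
  machine under \<open>q\<close> repeats its state forever and never gets to a return state, so a
  run that gets there meets no such query.\<close>

lemma funpow_step_mono:
  assumes q: "\<And>i. q i \<noteq> 0 \<Longrightarrow> q' i = q i"
  shows "(step q ^^ n) s = (0, v, k) \<Longrightarrow> (step q' ^^ n) s = (0, v, k)"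
proof (induction n arbitrary: s)
  case (Suc n)
  have "step q' s = step q s \<or> (step q s = s \<and> fst s \<noteq> 0)"
    using q[of "fst (snd s)"] by (cases s) (auto simp: step_def eval_step_def)
  then show ?case
  proof
    assume "step q' s = step q s"
    with Suc show ?thesis by (simp add: funpow_Suc_right del: funpow.simps)
  next
    assume *: "step q s = s \<and> fst s \<noteq> 0"
    then have "(step q ^^ m) s = s" for m by (induction m) auto
    with Suc.prems have "s = (0, v, k)" by metis
    with * show ?thesis by simp
  qed
qed simp

lemma run_mono:
  assumes run: "run e c x t = Suc y" and c: "\<And>i. lookup c i \<noteq> 0 \<Longrightarrow> lookup c' i = lookup c i"
    and "t \<le> t'"
  shows "run e c' x t' = Suc y"
proof -
  have halt: "(step q ^^ n) (0, y, 0) = (0, y, 0)" for q n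
    by (induction n) (auto simp: step_def)
  have "(step (lookup c) ^^ t) (Suc e, x, 0) = (0, y, 0)"
    using run by (auto simp: run_def split: prod.splits if_splits)
  then have "(step (lookup c') ^^ t) (Suc e, x, 0) = (0, y, 0)"
    using c by (rule funpow_step_mono[rotated])
  moreover have "(step (lookup c') ^^ t') s = (step (lookup c') ^^ (t' - t)) ((step (lookup c') ^^ t) s)" for s
    using \<open>t \<le> t'\<close> by (metis comp_apply funpow_add le_add_diff_inverse2)
  ultimately show ?thesis by (simp add: run_def halt)
qed

abbreviation rcode :: "baire \<Rightarrow> nat \<Rightarrow> nat" where "rcode g n \<equiv> list_encode (restr g n)"

lemma lookup_rcode: "lookup (rcode g n) i = (if i < n then Suc (g i) else 0)"
  by (simp add: lookup_list_encode)

lemma run_rcode_mono: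
  assumes "run e (rcode g m) x t = Suc y" "m \<le> n" "t \<le> t'"
  shows "run e (rcode g n) x t' = Suc y"
  using assms by (intro run_mono[OF assms(1)]) (auto simp: lookup_rcode split: if_splits)

lemma run_complete:
  assumes "Phi e g = Some f"
  shows "\<exists>N. \<forall>n\<ge>N. \<forall>t\<ge>N. run e (rcode g n) x t = Suc (f x)"
proof -
  from assms have "evals g (prog_of e) x (f x)" by (simp add: Phi_eq_Some_iff)
  from evals_imp_reach[OF this refl] obtain N where
    "\<And>q. \<forall>i<N. q i = Suc (g i) \<Longrightarrow> reach q (Suc e, x, 0) (0, f x, 0)" by blast
  then have "reach (lookup (rcode g N)) (Suc e, x, 0) (0, f x, 0)" by (simp add: lookup_rcode)
  then obtain t where "(step (lookup (rcode g N)) ^^ t) (Suc e, x, 0) = (0, f x, 0)"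
    unfolding reach_def by blast
  then have "run e (rcode g N) x t = Suc (f x)" by (simp add: run_def)
  then have "run e (rcode g n) x t' = Suc (f x)" if "n \<ge> max N t" "t' \<ge> max N t" for n t'
    using that by (auto intro: run_rcode_mono)
  then show ?thesis by blast
qed

text \<open>Soundness follows from completeness: by monotonicity the given result persists at later
  stages, where the result is \<open>f x\<close>.\<close>

lemma run_sound:
  assumes "Phi e g = Some f" "run e (rcode g n) x t = Suc y"
  shows "f x = y"
proof -
  obtain N where N: "run e (rcode g m) x s = Suc (f x)" if "m \<ge> N" "s \<ge> N" for m s
    using run_complete[OF assms(1)] by blast
  have "run e (rcode g (max n N)) x (max t N) = Suc y"
    using assms(2) by (rule run_rcode_mono) auto
  with N[of "max n N" "max t N"] show ?thesis by simp
qed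


section \<open>Indices of functionals\<close>

text \<open>Minimisation finds the first stage with a nonzero entry. All nonzero entries agree, so
  this entry is the value looked for.\<close>

lemma recursive_search:
  assumes "recursive T"
  shows "\<exists>p. \<forall>g x y. (\<exists>n. T g (pair x n) \<noteq> 0) \<and> (\<forall>n. T g (pair x n) \<in> {0, Suc y}) \<longrightarrow> evals g p x y"
proof -
  obtain pt where pt: "evals g pt z (if T g z = 0 then 1 else 0)" for g z
    using recursive_if0[OF assms recursive_const[of 1] recursive_const[of 0]]
    unfolding recursive_def by blast
  obtain pv where pv: "evals g pv z (T g z - 1)" for g z
    using recursive_pred[OF assms] unfolding recursive_def by blast
  obtain pid where pid: "evals g pid x x" for g x
    using recursive_id unfolding recursive_def by blast
  have "evals g (Comp pv (Tuple pid (Minim pt))) x y"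
    if T: "\<exists>n. T g (pair x n) \<noteq> 0" "\<forall>n. T g (pair x n) \<in> {0, Suc y}" for g x y
  proof -
    define n where "n = (LEAST n. T g (pair x n) \<noteq> 0)"
    have "T g (pair x n) \<noteq> 0" unfolding n_def using T(1) by (rule LeastI_ex)
    with T(2)[rule_format, of n] have n: "T g (pair x n) = Suc y" by simp
    have "T g (pair x m) = 0" if "m < n" for m
      using that not_less_Least unfolding n_def by blast
    then have "evals g pt (pair x m) (Suc 0)" if "m < n" for m
      using pt[of g "pair x m"] that by simp
    moreover have "evals g pt (pair x n) 0" using pt[of g "pair x n"] n by simp
    ultimately have "evals g (Minim pt) x n" by (intro evals.Minim) blast+
    then have "evals g (Tuple pid (Minim pt)) x (pair x n)" by (intro evals.Tuple pid)
    then show ?thesis using pv[of g "pair x n"] n by (auto intro: evals.Comp)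
  qed
  then show ?thesis by blast
qed

lemma prog_of_Comp: "prog_of (6 + 4 * pair a b) = Comp (prog_of a) (prog_of b)"
proof -
  have "Suc (4 * m) div 4 = m" "Suc (4 * m) mod 4 = 1" for m :: nat by presburger+
  then show ?thesis by (subst prog_of.simps) (simp add: Let_def)
qed

lemma prog_of_Tuple: "prog_of (5 + 4 * pair a b) = Tuple (prog_of a) (prog_of b)"
  by (subst prog_of.simps) (simp add: Let_def)

lemma smn: "\<exists>S. recursive (\<lambda>_. S) \<and> (\<forall>g z x y. evals g p (pair z x) y \<longrightarrow> evals g (prog_of (S z)) x y)"
proof -
  obtain u one zero idx where ix: "prog_of u = p" "prog_of one = Succ" "prog_of zero = Zero"
    "prog_of idx = Tuple Left Right"
    using surj_prog_of by (metis surjD)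
  \<comment> \<open>\<open>K z\<close> numbers a program for the constant \<open>z\<close>, namely
    \<open>Succ\<close> iterated over \<open>Zero\<close>. The numbers
    \<open>6 + 4 * pair a b\<close> and \<open>5 + 4 * pair a b\<close> denote a composition and a
    tuple, so \<open>S z\<close> feeds the pair of \<open>z\<close> and the input to
    \<open>p\<close>.\<close>
  define K where "K = rec_nat zero (\<lambda>_ c. 6 + 4 * pair one c)"
  define S where "S z = 6 + 4 * pair u (5 + 4 * pair (K z) idx)" for z
  have "recursive (\<lambda>_. S)" unfolding S_def K_def by (intro recursive_intros)
  moreover have "evals g (prog_of (S z)) x y" if "evals g p (pair z x) y" for g z x y
  proof -
    have "evals g (prog_of (K z)) x z"
      by (induction z) (auto simp: K_def prog_of_Comp ix intro: evals.intros)
    moreover have "evals g (Tuple Left Right) x x"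
      using evals.Tuple[OF evals.Left evals.Right, of g x] by simp
    ultimately show ?thesis
      using that by (auto simp: S_def prog_of_Comp prog_of_Tuple ix intro!: evals.Comp evals.Tuple)
  qed
  ultimately show ?thesis by blast
qed

text \<open>
  \<open>T g z x n = Suc y\<close> means that at stage \<open>n\<close> the functional with parameter \<open>z\<close> has been
  found to have the value \<open>y\<close> at \<open>x\<close>.
\<close>

lemma ex_index:
  assumes "recursive (\<lambda>g w. T g (pfst w) (pfst (psnd w)) (psnd (psnd w)))"
  shows "\<exists>S. recursive (\<lambda>_. S) \<and> (\<forall>g z f. (\<forall>x. (\<exists>n. T g z x n \<noteq> 0) \<and> (\<forall>n. T g z x n \<in> {0, Suc (f x)}))
    \<longrightarrow> Phi (S z) g = Some f)"
proof -
  have "recursive (\<lambda>g w. T g (pfst (pfst w)) (psnd (pfst w)) (psnd w))"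
    using recursive_comp[OF assms, of "\<lambda>_ w. pair (pfst (pfst w)) (pair (psnd (pfst w)) (psnd w))"]
    by (simp add: recursive_intros)
  from recursive_search[OF this] obtain p where
    p: "(\<exists>n. T g z x n \<noteq> 0) \<and> (\<forall>n. T g z x n \<in> {0, Suc y}) \<Longrightarrow> evals g p (pair z x) y" for g z x y
    by (auto simp del: insert_iff) (metis fst_conv prod_encode_inverse snd_conv)
  from smn[of p] obtain S where "recursive (\<lambda>_. S)"
    "\<And>g z x y. evals g p (pair z x) y \<Longrightarrow> evals g (prog_of (S z)) x y" by blast
  with p show ?thesis by (intro exI[of _ S]) (simp add: Phi_eq_Some_iff)
qed

definition join :: "baire \<Rightarrow> baire \<Rightarrow> baire" (infixl "\<oplus>" 65) where
  "(f \<oplus> g) x = pair (f x) (g x)"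

lemma recursive_join [recursive_intros]:
  "recursive (\<lambda>g. F g) \<Longrightarrow> recursive (\<lambda>g. H g) \<Longrightarrow> recursive (\<lambda>g. F g \<oplus> H g)"
  unfolding join_def by (intro recursive_intros)

lemma pfst_join [simp]: "pfst ((f \<oplus> g) x) = f x" and psnd_join [simp]: "psnd ((f \<oplus> g) x) = g x"
  by (simp_all add: join_def)

lemma ex_join_index:
  "\<exists>S. recursive (\<lambda>_. S) \<and>
    (\<forall>i j g f h. Phi i g = Some f \<longrightarrow> Phi j g = Some h \<longrightarrow> Phi (S (pair i j)) g = Some (f \<oplus> h))"
proof -
  define T where "T g z x n =
    (if run (pfst z) (rcode g n) x n = 0 then 0 else if run (psnd z) (rcode g n) x n = 0 then 0
     else Suc (pair (run (pfst z) (rcode g n) x n - 1) (run (psnd z) (rcode g n) x n - 1)))" for g z x n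
  have "recursive (\<lambda>g w. T g (pfst w) (pfst (psnd w)) (psnd (psnd w)))"
    unfolding T_def by (intro recursive_intros)
  from ex_index[of T, OF this] obtain S where S: "recursive (\<lambda>_. S)"
    "\<And>g z f. \<forall>x. (\<exists>n. T g z x n \<noteq> 0) \<and> (\<forall>n. T g z x n \<in> {0, Suc (f x)}) \<Longrightarrow> Phi (S z) g = Some f"
    by blast
  have "Phi (S (pair i j)) g = Some (f \<oplus> h)" if Phi: "Phi i g = Some f" "Phi j g = Some h" for i j g f h
  proof (intro S(2) allI conjI)
    fix x
    obtain N M where "\<And>n. n \<ge> N \<Longrightarrow> run i (rcode g n) x n = Suc (f x)"
      and "\<And>n. n \<ge> M \<Longrightarrow> run j (rcode g n) x n = Suc (h x)"
      using run_complete[OF Phi(1)] run_complete[OF Phi(2)] by metis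
    then have "T g (pair i j) x (max N M) \<noteq> 0" by (simp add: T_def)
    then show "\<exists>n. T g (pair i j) x n \<noteq> 0" ..
    fix n
    show "T g (pair i j) x n \<in> {0, Suc ((f \<oplus> h) x)}"
      using run_sound[OF Phi(1), of n x n] run_sound[OF Phi(2), of n x n]
      by (auto simp: T_def join_def gr0_conv_Suc)
  qed
  with S(1) show ?thesis by blast
qed

text \<open>The index to be run may be computed from the oracle itself. This allows a single
  reduction to execute the index stored in its input.\<close>

lemma ex_universal:
  assumes "recursive (\<lambda>g x. Q g)"
  shows "\<exists>v. \<forall>g h. Phi (Q g) g = Some h \<longrightarrow> Phi v g = Some h"
proof -
  define T where "T g z x n = run (Q g) (rcode g n) x n" for g :: baire and z x n :: nat
  have "recursive (\<lambda>g w. T g (pfst w) (pfst (psnd w)) (psnd (psnd w)))"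
    unfolding T_def by (intro recursive_intros assms)
  from ex_index[of T, OF this] obtain S where S:
    "\<And>g z f. \<forall>x. (\<exists>n. T g z x n \<noteq> 0) \<and> (\<forall>n. T g z x n \<in> {0, Suc (f x)}) \<Longrightarrow> Phi (S z) g = Some f"
    by blast
  have "Phi (S 0) g = Some h" if Phi: "Phi (Q g) g = Some h" for g h
  proof (intro S allI conjI)
    fix x
    obtain N where "\<And>n. n \<ge> N \<Longrightarrow> run (Q g) (rcode g n) x n = Suc (h x)"
      using run_complete[OF Phi] by metis
    then have "T g 0 x N \<noteq> 0" by (simp add: T_def)
    then show "\<exists>n. T g 0 x n \<noteq> 0" ..
    fix n
    show "T g 0 x n \<in> {0, Suc (h x)}"
      using run_sound[OF Phi, of n x n] by (cases "run (Q g) (rcode g n) x n") (auto simp: T_def)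
  qed
  then show ?thesis by blast
qed

lemma ex_const_join_index:
  "\<exists>S. recursive (\<lambda>_. S) \<and> (\<forall>j g. Phi (S j) g = Some ((\<lambda>_. j) \<oplus> g))"
proof -
  define T where "T g z x n = Suc (pair z (g x))" for g :: baire and z x n :: nat
  have "recursive (\<lambda>g w. T g (pfst w) (pfst (psnd w)) (psnd (psnd w)))"
    unfolding T_def by (intro recursive_intros)
  from ex_index[of T, OF this] show ?thesis by (auto simp: T_def join_def)
qed


section \<open>Composition of indices\<close>

text \<open>The counter advances only while \<open>y = k\<close>, so it stops for good at the first
  argument without a result. What remains is the length of the output segment obtained within
  \<open>n\<close> steps, cut off at \<open>n\<close>.\<close>

definition approx_length :: "nat \<Rightarrow> nat \<Rightarrow> nat \<Rightarrow> nat" where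
  "approx_length i c n = rec_nat 0 (\<lambda>k y. if y = k \<and> run i c k n \<noteq> 0 then Suc k else y) n"

definition approx :: "nat \<Rightarrow> nat list \<Rightarrow> nat list" where
  "approx i \<sigma> = map (\<lambda>x. run i (list_encode \<sigma>) x (length \<sigma>) - 1)
    [0..<approx_length i (list_encode \<sigma>) (length \<sigma>)]"

lemma recursive_approx [recursive_intros]:
  assumes I: "recursive I" and S: "recursive (\<lambda>g x. list_encode (S g x))"
  shows "recursive (\<lambda>g x. list_encode (approx (I g x) (S g x)))"
  unfolding approx_def approx_length_def
  by (intro recursive_intros recursive_comp[OF I] recursive_comp[OF S]
      recursive_comp[OF recursive_length[OF S]] I S)

lemma approx_length:
  "approx_length i c n \<le> n"
  "x < approx_length i c n \<Longrightarrow> run i c x n \<noteq> 0"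
  "approx_length i c n = n \<or> run i c (approx_length i c n) n = 0"
proof -
  define r where "r = rec_nat 0 (\<lambda>k y. if y = k \<and> run i c k n \<noteq> 0 then Suc k else y)"
  have "r N \<le> N \<and> (\<forall>x<r N. run i c x n \<noteq> 0) \<and> (r N = N \<or> run i c (r N) n = 0)" for N
    by (induction N) (auto simp: r_def less_Suc_eq)
  from this[of n] show "approx_length i c n \<le> n" "x < approx_length i c n \<Longrightarrow> run i c x n \<noteq> 0"
    "approx_length i c n = n \<or> run i c (approx_length i c n) n = 0"
    by (auto simp: approx_length_def r_def)
qed

lemma mono_approx_length: "mono (\<lambda>n. approx_length i (rcode g n) n)"
  unfolding mono_iff_le_Suc
proof (rule allI, rule ccontr)
  fix n
  let ?m = "approx_length i (rcode g (Suc n)) (Suc n)"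
  assume "\<not> approx_length i (rcode g n) n \<le> ?m"
  then have less: "?m < approx_length i (rcode g n) n" by simp
  then obtain y where "run i (rcode g n) ?m n = Suc y"
    using approx_length(2) by (meson not0_implies_Suc)
  then have "run i (rcode g (Suc n)) ?m (Suc n) = Suc y" by (rule run_rcode_mono) auto
  then show False using approx_length(3)[of i "rcode g (Suc n)" "Suc n"] approx_length(1)[of i "rcode g n" n] less
    by simp
qed

text \<open>Results persist once found, so the approximations are segments of one function even if
  program \<open>i\<close> is not total on \<open>g\<close>. This controls a second learner that is
  fed the output of a wrong hypothesis.\<close>

lemma approx_eq_restr:
  "\<exists>f. \<forall>n. approx i (restr g n) = restr f (approx_length i (rcode g n) n)"
proof -
  have "\<exists>y. \<forall>n z. run i (rcode g n) x n = Suc z \<longrightarrow> z = y" for x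
  proof (cases "\<exists>n y. run i (rcode g n) x n = Suc y")
    case True
    then obtain n y where y: "run i (rcode g n) x n = Suc y" by blast
    have "z = y" if "run i (rcode g m) x m = Suc z" for m z
      using run_rcode_mono[OF y, of "max m n" "max m n"] run_rcode_mono[OF that, of "max m n" "max m n"]
      by simp
    then show ?thesis by blast
  qed auto
  then obtain f where f: "run i (rcode g n) x n = Suc z \<Longrightarrow> z = f x" for x n z by metis
  have "run i (rcode g n) x n - 1 = f x" if "x < approx_length i (rcode g n) n" for n x
    using approx_length(2)[OF that] f by (metis Suc_diff_1 gr0I)
  then show ?thesis by (intro exI[of _ f]) (simp add: approx_def restr_def)
qed

lemma approx_total:
  assumes "Phi i g = Some f"
  shows "approx i (restr g n) = restr f (approx_length i (rcode g n) n)"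
    and "\<exists>N. \<forall>n\<ge>N. L \<le> approx_length i (rcode g n) n"
proof -
  have "run i (rcode g n) x n - 1 = f x" if "x < approx_length i (rcode g n) n" for n x
    using approx_length(2)[OF that] run_sound[OF assms] by (metis Suc_diff_1 gr0I)
  then show "approx i (restr g n) = restr f (approx_length i (rcode g n) n)"
    by (simp add: approx_def restr_def)
  have "\<exists>N. \<forall>n\<ge>N. run i (rcode g n) x n = Suc (f x)" for x
    using run_complete[OF assms] by meson
  then obtain N where N: "\<And>x n. n \<ge> N x \<Longrightarrow> run i (rcode g n) x n = Suc (f x)" by metis
  \<comment> \<open>The maximum contains \<open>L\<close> because the approximation never gets
    longer than \<open>n\<close>; a length below \<open>L\<close> is then due to a missing result,
    which the bounds \<open>N\<close> exclude.\<close>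
  have "L \<le> approx_length i (rcode g n) n" if n: "n \<ge> Max (insert L (N ` {..<L}))" for n
  proof (rule ccontr)
    assume less: "\<not> L \<le> approx_length i (rcode g n) n"
    then have "N (approx_length i (rcode g n) n) \<le> n" "approx_length i (rcode g n) n < n"
      using n by (auto simp: Max_le_iff)
    then show False using N approx_length(3) by (metis nat.distinct(1) nat_neq_iff)
  qed
  then show "\<exists>N. \<forall>n\<ge>N. L \<le> approx_length i (rcode g n) n" by blast
qed

lemma ex_comp_index:
  "\<exists>S. recursive (\<lambda>_. S) \<and>
    (\<forall>i j g f h. Phi i g = Some f \<longrightarrow> Phi j f = Some h \<longrightarrow> Phi (S (pair i j)) g = Some h)"
proof -
  \<comment> \<open>The second program runs on the part of the output of the first one that is
    available at stage \<open>n\<close>.\<close>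
  define T where "T g z x n = run (psnd z) (list_encode (approx (pfst z) (restr g n))) x n" for g z x n
  have "recursive (\<lambda>g w. T g (pfst w) (pfst (psnd w)) (psnd (psnd w)))"
    unfolding T_def by (intro recursive_intros)
  from ex_index[of T, OF this] obtain S where S: "recursive (\<lambda>_. S)"
    "\<And>g z f. \<forall>x. (\<exists>n. T g z x n \<noteq> 0) \<and> (\<forall>n. T g z x n \<in> {0, Suc (f x)}) \<Longrightarrow> Phi (S z) g = Some f"
    by blast
  have "Phi (S (pair i j)) g = Some h" if Phi: "Phi i g = Some f" "Phi j f = Some h" for i j g f h
  proof (intro S(2) allI conjI)
    have T: "T g (pair i j) x n = run j (rcode f (approx_length i (rcode g n) n)) x n" for x n
      by (simp add: T_def approx_total(1)[OF Phi(1)])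
    fix x
    obtain L where L: "\<And>n t. n \<ge> L \<Longrightarrow> t \<ge> L \<Longrightarrow> run j (rcode f n) x t = Suc (h x)"
      using run_complete[OF Phi(2)] by metis
    obtain N where N: "\<And>n. n \<ge> N \<Longrightarrow> L \<le> approx_length i (rcode g n) n"
      using approx_total(2)[OF Phi(1)] by metis
    have "T g (pair i j) x (max N L) \<noteq> 0" using L N[of "max N L"] by (simp add: T)
    then show "\<exists>n. T g (pair i j) x n \<noteq> 0" ..
    fix n
    show "T g (pair i j) x n \<in> {0, Suc (h x)}"
      using run_sound[OF Phi(2), of "approx_length i (rcode g n) n" x n]
      by (cases "T g (pair i j) x n") (auto simp: T)
  qed
  with S(1) show ?thesis by blast
qed

text \<open>Fixing one computable function turns composition into an operation that a learner can
  apply to its current hypotheses.\<close>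

definition comp_index :: "nat \<Rightarrow> nat" where
  "comp_index = (SOME S. recursive (\<lambda>_. S) \<and>
    (\<forall>i j g f h. Phi i g = Some f \<longrightarrow> Phi j f = Some h \<longrightarrow> Phi (S (pair i j)) g = Some h))"

lemma comp_index: "recursive (\<lambda>_. comp_index)"
  "Phi i g = Some f \<Longrightarrow> Phi j f = Some h \<Longrightarrow> Phi (comp_index (pair i j)) g = Some h"
  using someI_ex[OF ex_comp_index] unfolding comp_index_def by blast+

definition join_index :: "nat \<Rightarrow> nat" where
  "join_index = (SOME S. recursive (\<lambda>_. S) \<and>
    (\<forall>i j g f h. Phi i g = Some f \<longrightarrow> Phi j g = Some h \<longrightarrow> Phi (S (pair i j)) g = Some (f \<oplus> h)))"

lemma join_index: "recursive (\<lambda>_. join_index)"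
  "Phi i g = Some f \<Longrightarrow> Phi j g = Some h \<Longrightarrow> Phi (join_index (pair i j)) g = Some (f \<oplus> h)"
  using someI_ex[OF ex_join_index] unfolding join_index_def by blast+

lemma turing_le_trans: "turing_le f g \<Longrightarrow> turing_le g h \<Longrightarrow> turing_le f h"
  unfolding turing_le_def using comp_index(2) by metis

lemma turing_le_join: "turing_le f h \<Longrightarrow> turing_le g h \<Longrightarrow> turing_le (f \<oplus> g) h"
  unfolding turing_le_def using join_index(2) by metis

lemma turing_le_recursive:
  assumes "recursive F" shows "turing_le (F g) g"
  using recursive_imp_Phi[OF assms] unfolding turing_le_def by blast

lemma turing_le_refl: "turing_le g g"
  by (rule turing_le_recursive) (intro recursive_intros)

lemma turing_le_join_left: "turing_le f (f \<oplus> g)" and turing_le_join_right: "turing_le g (f \<oplus> g)"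
proof -
  have "recursive (\<lambda>g x. pfst (g x))" "recursive (\<lambda>g x. psnd (g x))" by (intro recursive_intros)+
  from this[THEN turing_le_recursive, of "f \<oplus> g"]
  show "turing_le f (f \<oplus> g)" "turing_le g (f \<oplus> g)" by simp_all
qed


section \<open>Learners with bounded resources and the preorders induced by families of them\<close>

section \<open>Counting hypotheses and mind changes\<close>

primrec mind_changes :: "(nat \<Rightarrow> nat) \<Rightarrow> nat \<Rightarrow> nat" where
  "mind_changes v 0 = 0"
| "mind_changes v (Suc n) = mind_changes v n + of_bool (v (Suc n) \<noteq> v n)"

definition hypotheses :: "(nat \<Rightarrow> nat) \<Rightarrow> nat \<Rightarrow> nat" where
  "hypotheses v n = card (v ` {..n})"

lemma mind_changes_eq_card: "mind_changes v n = card {j. j < n \<and> v (Suc j) \<noteq> v j}"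
proof (induction n)
  case (Suc n)
  have "{j. j < Suc n \<and> v (Suc j) \<noteq> v j} =
      (if v (Suc n) \<noteq> v n then insert n else id) {j. j < n \<and> v (Suc j) \<noteq> v j}"
    by (auto simp: less_Suc_eq)
  with Suc show ?case by simp
qed simp

lemma hypotheses_le: "hypotheses v n \<le> Suc (mind_changes v n)"
proof (induction n)
  case (Suc n)
  have "v ` {..Suc n} = insert (v (Suc n)) (v ` {..n})" by (auto simp: atMost_Suc)
  with Suc show ?case by (auto simp: hypotheses_def card_insert_if)
qed (simp add: hypotheses_def)

text \<open>The common properties of no bound, a bound on mind changes and a bound on hypotheses.
  \<open>cnt_subseq\<close> and \<open>cnt_cap\<close> handle a learner fed with approximations, and
  \<open>ex_cnt_bind\<close> combines two learners, where the sequence of the second depends on the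
  current hypothesis \<open>v n\<close> of the first. \<open>cnt_mono_le\<close> is for learners
  that follow a bounded increasing sequence.\<close>

locale counter =
  fixes cnt :: "(nat \<Rightarrow> nat) \<Rightarrow> nat \<Rightarrow> nat"
  assumes cnt_cong: "(\<And>j. j \<le> n \<Longrightarrow> v j = w j) \<Longrightarrow> cnt v n = cnt w n"
    and cnt_subseq: "mono m \<Longrightarrow> (\<And>n. cnt v n \<le> k) \<Longrightarrow> cnt (\<lambda>n. v (m n)) n \<le> k"
    and ex_cnt_bind: "\<exists>b. \<forall>v u F. (\<forall>n. cnt v n \<le> k) \<longrightarrow> (\<forall>i n. cnt (u i) n \<le> l) \<longrightarrow>
      (\<forall>n. cnt (\<lambda>n. F (v n) (u (v n) n)) n \<le> b)"
    and cnt_cap: "cnt (\<lambda>n. if cnt v n \<le> k then v n else 0) n \<le> Suc k"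
    and cnt_mono_le: "mono v \<Longrightarrow> (\<And>n. v n \<le> k) \<Longrightarrow> cnt v n \<le> Suc k"
    and cnt_const: "cnt (\<lambda>_. c) n \<le> 1"
    and recursive_cnt: "recursive (\<lambda>g z. W g (pfst z) (psnd z)) \<Longrightarrow> recursive N \<Longrightarrow>
      recursive (\<lambda>g x. cnt (W g x) (N g x))"

lemma recursive_uncurry:
  assumes "recursive (\<lambda>g z. w g (pfst z) (psnd z))" "recursive A" "recursive B"
  shows "recursive (\<lambda>g x. w g (A g x) (B g x))"
  using recursive_comp[OF assms(1) recursive_pair[OF assms(2,3)]] by simp

interpretation zero: counter "\<lambda>_ _. 0"
  by unfold_locales (auto intro: recursive_const)

interpretation mind_changes: counter mind_changes
proof
  fix v w :: "nat \<Rightarrow> nat" and n assume "\<And>j. j \<le> n \<Longrightarrow> v j = w j"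
  then show "mind_changes v n = mind_changes w n" by (induction n) auto
next
  fix m v :: "nat \<Rightarrow> nat" and k n
  assume "mono m" and k: "\<And>n. mind_changes v n \<le> k"
  have *: "mind_changes v a + of_bool (v b \<noteq> v a) \<le> mind_changes v b" if "a \<le> b" for a b
    using that by (induction b rule: dec_induct) auto
  have "mind_changes (\<lambda>n. v (m n)) n \<le> mind_changes v (m n)"
  proof (induction n)
    case (Suc n)
    then show ?case using *[of "m n" "m (Suc n)"] \<open>mono m\<close> by (simp add: mono_def)
  qed simp
  also have "\<dots> \<le> k" by (rule k)
  finally show "mind_changes (\<lambda>n. v (m n)) n \<le> k" .
next
  fix k l :: nat
  have "mind_changes (\<lambda>n. F (v n) (u (v n) n)) n \<le> k + Suc k * l"
    if v: "\<And>n. mind_changes v n \<le> k" and u: "\<And>i n. mind_changes (u i) n \<le> l"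
    for v :: "nat \<Rightarrow> nat" and u :: "nat \<Rightarrow> nat \<Rightarrow> nat" and F :: "nat \<Rightarrow> nat \<Rightarrow> nat" and n
  proof -
    let ?C = "\<lambda>v. {j. j < n \<and> v (Suc j) \<noteq> v j}"
    \<comment> \<open>A change of the combined sequence comes from a change of \<open>v\<close> or
      from a change of \<open>u i\<close> for the current \<open>i\<close>, and at most
      \<open>Suc k\<close> values of \<open>i\<close> occur.\<close>
    have "?C (\<lambda>n. F (v n) (u (v n) n)) \<subseteq> ?C v \<union> (\<Union>i\<in>v ` {..n}. ?C (u i))" by auto
    then have "mind_changes (\<lambda>n. F (v n) (u (v n) n)) n \<le> card (?C v \<union> (\<Union>i\<in>v ` {..n}. ?C (u i)))"
      unfolding mind_changes_eq_card by (intro card_mono) auto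
    also have "\<dots> \<le> card (?C v) + card (\<Union>i\<in>v ` {..n}. ?C (u i))" by (rule card_Un_le)
    also have "card (\<Union>i\<in>v ` {..n}. ?C (u i)) \<le> (\<Sum>i\<in>v ` {..n}. card (?C (u i)))"
      by (rule card_UN_le) simp
    also have "\<dots> \<le> hypotheses v n * l"
      using sum_bounded_above[of "v ` {..n}" "\<lambda>i. card (?C (u i))" l] u
      by (simp add: hypotheses_def mind_changes_eq_card)
    also have "hypotheses v n * l \<le> Suc k * l"
      using hypotheses_le[of v n] v[of n] by (intro mult_right_mono) auto
    finally show ?thesis using v[of n] by (simp add: mind_changes_eq_card)
  qed
  then show "\<exists>b. \<forall>v u F. (\<forall>n. mind_changes v n \<le> k) \<longrightarrow> (\<forall>i n. mind_changes (u i) n \<le> l) \<longrightarrow>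
      (\<forall>n. mind_changes (\<lambda>n. F (v n) (u (v n) n)) n \<le> b)"
    by (intro exI[of _ "k + Suc k * l"]) blast
next
  fix v :: "nat \<Rightarrow> nat" and k n
  let ?t = "\<lambda>n. if mind_changes v n \<le> k then v n else 0"
  \<comment> \<open>Once the bound is exceeded the sequence stays at 0, which costs at most one
    further change.\<close>
  have "mind_changes ?t n \<le> (if mind_changes v n \<le> k then mind_changes v n else Suc k)"
    by (induction n) (auto split: if_splits)
  then show "mind_changes ?t n \<le> Suc k" by (auto split: if_splits)
next
  fix v :: "nat \<Rightarrow> nat" and k n
  assume "mono v" and k: "\<And>n. v n \<le> k"
  have "mind_changes v n \<le> v n"
  proof (induction n)
    case (Suc n)
    then show ?case using monoD[OF \<open>mono v\<close>, of n "Suc n"] by auto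
  qed simp
  with k[of n] show "mind_changes v n \<le> Suc k" by simp
next
  fix c n :: nat
  have "mind_changes (\<lambda>_. c) n = 0" by (induction n) auto
  then show "mind_changes (\<lambda>_. c) n \<le> 1" by simp
next
  fix w :: "baire \<Rightarrow> nat \<Rightarrow> nat \<Rightarrow> nat" and N
  assume w: "recursive (\<lambda>g z. w g (pfst z) (psnd z))" and N: "recursive N"
  have "mind_changes v n = rec_nat 0 (\<lambda>j y. if v (Suc j) = v j then y else Suc y) n" for v n
    by (induction n) auto
  then show "recursive (\<lambda>g x. mind_changes (w g x) (N g x))"
    using N by (simp only:) (intro recursive_intros recursive_uncurry[OF w])
qed

interpretation hypotheses: counter hypotheses
proof
  fix v w :: "nat \<Rightarrow> nat" and n assume "\<And>j. j \<le> n \<Longrightarrow> v j = w j"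
  then show "hypotheses v n = hypotheses w n" unfolding hypotheses_def by (metis atMost_iff image_cong)
next
  fix m v :: "nat \<Rightarrow> nat" and k n
  assume m: "mono m" and k: "\<And>n. hypotheses v n \<le> k"
  have "(\<lambda>n. v (m n)) ` {..n} \<subseteq> v ` {..m n}" using m by (auto simp: mono_def)
  then have "hypotheses (\<lambda>n. v (m n)) n \<le> hypotheses v (m n)"
    unfolding hypotheses_def by (intro card_mono) auto
  also have "\<dots> \<le> k" by (rule k)
  finally show "hypotheses (\<lambda>n. v (m n)) n \<le> k" .
next
  fix k l :: nat
  have "hypotheses (\<lambda>n. F (v n) (u (v n) n)) n \<le> k * l"
    if v: "\<And>n. hypotheses v n \<le> k" and u: "\<And>i n. hypotheses (u i) n \<le> l"
    for v :: "nat \<Rightarrow> nat" and u :: "nat \<Rightarrow> nat \<Rightarrow> nat" and F :: "nat \<Rightarrow> nat \<Rightarrow> nat" and n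
  proof -
    \<comment> \<open>At most \<open>k\<close> values of \<open>i\<close> occur, and each
      contributes at most \<open>l\<close> values.\<close>
    have "hypotheses (\<lambda>n. F (v n) (u (v n) n)) n \<le> card (\<Union>i\<in>v ` {..n}. F i ` u i ` {..n})"
      unfolding hypotheses_def by (intro card_mono) auto
    also have "\<dots> \<le> (\<Sum>i\<in>v ` {..n}. card (F i ` u i ` {..n}))"
      by (rule card_UN_le) simp
    also have "\<dots> \<le> (\<Sum>i\<in>v ` {..n}. l)"
    proof (rule sum_mono)
      fix i
      have "card (F i ` u i ` {..n}) \<le> card (u i ` {..n})" by (rule card_image_le) simp
      also have "\<dots> \<le> l" using u[of i n] by (simp add: hypotheses_def)
      finally show "card (F i ` u i ` {..n}) \<le> l" .
    qed
    also have "\<dots> = hypotheses v n * l" by (simp add: hypotheses_def)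
    also have "\<dots> \<le> k * l" using v by (intro mult_right_mono) auto
    finally show ?thesis .
  qed
  then show "\<exists>b. \<forall>v u F. (\<forall>n. hypotheses v n \<le> k) \<longrightarrow> (\<forall>i n. hypotheses (u i) n \<le> l) \<longrightarrow>
      (\<forall>n. hypotheses (\<lambda>n. F (v n) (u (v n) n)) n \<le> b)"
    by (intro exI[of _ "k * l"]) blast
next
  fix v :: "nat \<Rightarrow> nat" and k n
  define t where "t n = (if hypotheses v n \<le> k then v n else 0)" for n
  have mono: "hypotheses v i \<le> hypotheses v j" if "i \<le> j" for i j
    unfolding hypotheses_def using that by (intro card_mono) auto
  have eq: "hypotheses t n = hypotheses v n" if "hypotheses v n \<le> k" for n
  proof -
    have "t j = v j" if "j \<le> n" for j
      using mono[OF that] \<open>hypotheses v n \<le> k\<close> by (simp add: t_def)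
    then have "t ` {..n} = v ` {..n}" by (intro image_cong) auto
    then show ?thesis by (simp add: hypotheses_def)
  qed
  have "hypotheses t n \<le> Suc k"
  proof (induction n)
    case 0
    show ?case by (simp add: hypotheses_def)
  next
    case (Suc n)
    have ins: "t ` {..Suc n} = insert (t (Suc n)) (t ` {..n})" by (auto simp: atMost_Suc)
    \<comment> \<open>A value beyond the first \<open>k\<close> can appear only when the bound is
      first exceeded; afterwards the sequence stays at 0.\<close>
    show ?case
    proof (cases "hypotheses v n \<le> k")
      case True
      then have "card (t ` {..n}) \<le> Suc k - 1" using eq[OF True] by (simp add: hypotheses_def)
      then show ?thesis unfolding hypotheses_def ins by (rule card_insert_le_m1[rotated]) simp
    next
      case False
      moreover from this have "\<not> hypotheses v (Suc n) \<le> k" using mono[of n "Suc n"] by simp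
      ultimately have "t (Suc n) = t n" by (simp add: t_def)
      then have "t (Suc n) \<in> t ` {..n}" by auto
      with Suc show ?thesis unfolding hypotheses_def ins by (simp add: insert_absorb)
    qed
  qed
  then show "hypotheses (\<lambda>n. if hypotheses v n \<le> k then v n else 0) n \<le> Suc k"
    by (simp add: t_def[abs_def])
next
  fix v :: "nat \<Rightarrow> nat" and k n
  assume "\<And>n. v n \<le> k"
  then have "v ` {..n} \<subseteq> {..k}" by auto
  from card_mono[OF _ this] show "hypotheses v n \<le> Suc k" by (simp add: hypotheses_def)
next
  fix c n :: nat
  have "(\<lambda>_. c) ` {..n} = {c}" by auto
  then show "hypotheses (\<lambda>_. c) n \<le> 1" unfolding hypotheses_def by simp
next
  fix w :: "baire \<Rightarrow> nat \<Rightarrow> nat \<Rightarrow> nat" and N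
  assume w: "recursive (\<lambda>g z. w g (pfst z) (psnd z))" and N: "recursive N"
  define seen where "seen v c = rec_nat (0 :: nat) (\<lambda>i y. if v i = c then 1 else y)" for v :: "nat \<Rightarrow> nat" and c
  have seen: "seen v c n = of_bool (c \<in> v ` {..<n})" for v c n
    by (induction n) (auto simp: seen_def lessThan_Suc)
  have "hypotheses v n = rec_nat 1 (\<lambda>j y. if seen v (v (Suc j)) (Suc j) = 0 then Suc y else y) n" for v n
  proof (induction n)
    case (Suc n)
    have "v ` {..Suc n} = insert (v (Suc n)) (v ` {..n})" by (auto simp: atMost_Suc)
    with Suc show ?case by (simp add: seen lessThan_Suc_atMost hypotheses_def card_insert_if)
  qed (simp add: hypotheses_def)
  then show "recursive (\<lambda>g x. hypotheses (w g x) (N g x))"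
    using N by (simp only: seen_def) (intro recursive_intros recursive_uncurry[OF w])
qed


section \<open>Reducibility by families of learners\<close>

definition succeeds :: "((nat \<Rightarrow> nat) \<Rightarrow> nat \<Rightarrow> nat) \<Rightarrow> nat \<Rightarrow> (nat list \<Rightarrow> nat) \<Rightarrow> baire set \<Rightarrow> baire \<Rightarrow> bool" where
  "succeeds cnt k \<psi> A g \<longleftrightarrow> (\<forall>n. cnt (\<lambda>n. \<psi> (restr g n)) n \<le> k) \<and>
    (\<exists>i. \<exists>f\<in>A. (\<forall>\<^sub>F n in sequentially. \<psi> (restr g n) = i) \<and> Phi i g = Some f)"

text \<open>\<open>K\<close> regulates how many learners a reduction may use: its members are
  singletons, finite sets or one whole class. The bound \<open>k\<close> is uniform over
  \<open>B\<close>.\<close>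

definition red :: "(nat list \<Rightarrow> nat) set set \<Rightarrow> ((nat \<Rightarrow> nat) \<Rightarrow> nat \<Rightarrow> nat) \<Rightarrow> baire set \<Rightarrow> baire set \<Rightarrow> bool" where
  "red K cnt A B \<longleftrightarrow> (\<exists>S\<in>K. \<exists>k. \<forall>g\<in>B. \<exists>\<psi>\<in>S. succeeds cnt k \<psi> A g)"

text \<open>A learner obeys its bound only on the inputs it is meant for. In a composition it may be
  fed segments produced by wrong hypotheses; the cap enforces the bound there and changes nothing on
  good inputs.\<close>

definition cap :: "((nat \<Rightarrow> nat) \<Rightarrow> nat \<Rightarrow> nat) \<Rightarrow> nat \<Rightarrow> (nat list \<Rightarrow> nat) \<Rightarrow> nat list \<Rightarrow> nat" where
  "cap cnt k \<psi> \<sigma> = (if cnt (\<lambda>j. \<psi> (take j \<sigma>)) (length \<sigma>) \<le> k then \<psi> \<sigma> else 0)"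

definition comp_learner :: "(nat list \<Rightarrow> nat) \<Rightarrow> (nat list \<Rightarrow> nat) \<Rightarrow> nat list \<Rightarrow> nat" where
  "comp_learner \<psi> \<psi>' \<sigma> = comp_index (pair (\<psi> \<sigma>) (\<psi>' (approx (\<psi> \<sigma>) \<sigma>)))"

definition join_learner :: "(nat list \<Rightarrow> nat) \<Rightarrow> (nat list \<Rightarrow> nat) \<Rightarrow> nat list \<Rightarrow> nat" where
  "join_learner \<psi> \<psi>' \<sigma> = join_index (pair (\<psi> \<sigma>) (\<psi>' \<sigma>))"

definition joins :: "baire set \<Rightarrow> baire set \<Rightarrow> baire set" (infixl "\<otimes>" 70) where
  "A \<otimes> B = {f \<oplus> g | f g. f \<in> A \<and> g \<in> B}"

context counter
begin

lemma cap_restr: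
  "cap cnt k \<psi> (restr g n) = (if cnt (\<lambda>j. \<psi> (restr g j)) n \<le> k then \<psi> (restr g n) else 0)"
proof -
  have "cnt (\<lambda>j. \<psi> (take j (restr g n))) n = cnt (\<lambda>j. \<psi> (restr g j)) n"
    by (rule cnt_cong) (simp add: take_restr)
  then show ?thesis by (simp add: cap_def)
qed

lemma recursive_cap:
  assumes "learner \<psi>" and S: "recursive (\<lambda>g x. list_encode (S g x))"
  shows "recursive (\<lambda>g x. cap cnt k \<psi> (S g x))"
  unfolding cap_def
  by (intro recursive_intros recursive_cnt recursive_learner[OF assms(1)] recursive_comp[OF S] assms)

text \<open>For a fixed \<open>i\<close> the approximations run through segments of one function in
  increasing order, so \<open>cnt_subseq\<close> transfers the bound for the capped learner on that
  function.\<close>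

lemma cnt_cap_approx: "cnt (\<lambda>n. cap cnt k \<psi> (approx i (restr g n))) n \<le> Suc k"
proof -
  obtain f where "\<And>n. approx i (restr g n) = restr f (approx_length i (rcode g n) n)"
    using approx_eq_restr by blast
  then have "(\<lambda>n. cap cnt k \<psi> (approx i (restr g n))) =
      (\<lambda>n. (\<lambda>n. if cnt (\<lambda>j. \<psi> (restr f j)) n \<le> k then \<psi> (restr f n) else 0) (approx_length i (rcode g n) n))"
    by (simp add: cap_restr)
  then show ?thesis
    by (simp only:) (rule cnt_subseq[OF mono_approx_length cnt_cap])
qed

lemma ex_succeeds_comp:
  assumes S: "\<forall>f\<in>B. \<exists>\<psi>'\<in>S. succeeds cnt l \<psi>' A f"
  shows "\<exists>b. \<forall>\<psi> g. succeeds cnt k \<psi> B g \<longrightarrow> (\<exists>\<psi>'\<in>S. succeeds cnt b (comp_learner \<psi> (cap cnt l \<psi>')) A g)"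
proof -
  obtain b where b: "\<And>v u F n. \<forall>n. cnt v n \<le> k \<Longrightarrow> \<forall>i n. cnt (u i) n \<le> Suc l \<Longrightarrow>
      cnt (\<lambda>n. F (v n) (u (v n) n)) n \<le> b"
    using ex_cnt_bind[of k "Suc l"] by blast
  have "\<exists>\<psi>'\<in>S. succeeds cnt b (comp_learner \<psi> (cap cnt l \<psi>')) A g"
    if \<psi>: "succeeds cnt k \<psi> B g" for \<psi> g
  proof -
    from \<psi> obtain i f where f: "f \<in> B" "Phi i g = Some f"
      and i: "\<forall>\<^sub>F n in sequentially. \<psi> (restr g n) = i" and k: "\<forall>n. cnt (\<lambda>n. \<psi> (restr g n)) n \<le> k"
      unfolding succeeds_def by blast
    from S f(1) obtain \<psi>' where \<psi>': "\<psi>' \<in> S" "succeeds cnt l \<psi>' A f" by blast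
    from \<psi>'(2) obtain j h where h: "h \<in> A" "Phi j f = Some h"
      and j: "\<forall>\<^sub>F n in sequentially. \<psi>' (restr f n) = j" and l: "\<forall>n. cnt (\<lambda>n. \<psi>' (restr f n)) n \<le> l"
      unfolding succeeds_def by blast
    let ?\<chi> = "comp_learner \<psi> (cap cnt l \<psi>')"
    have "cnt (\<lambda>n. ?\<chi> (restr g n)) n \<le> b" for n
      unfolding comp_learner_def
      using b[OF k, of "\<lambda>i n. cap cnt l \<psi>' (approx i (restr g n))" "\<lambda>i j. comp_index (pair i j)" n]
      by (simp add: cnt_cap_approx)
    moreover have "\<forall>\<^sub>F n in sequentially. ?\<chi> (restr g n) = comp_index (pair i j)"
    proof -
      from j obtain L where L: "\<And>n. n \<ge> L \<Longrightarrow> \<psi>' (restr f n) = j" unfolding eventually_sequentially by blast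
      obtain N where N: "\<And>n. n \<ge> N \<Longrightarrow> L \<le> approx_length i (rcode g n) n"
        using approx_total(2)[OF f(2)] by metis
      have "cap cnt l \<psi>' (approx i (restr g n)) = j" if "n \<ge> N" for n
        using L N[OF that] l by (simp add: approx_total(1)[OF f(2)] cap_restr)
      then have "\<forall>\<^sub>F n in sequentially. cap cnt l \<psi>' (approx i (restr g n)) = j"
        unfolding eventually_sequentially by blast
      with i show ?thesis by eventually_elim (simp add: comp_learner_def)
    qed
    ultimately have "succeeds cnt b ?\<chi> A g"
      using h(1) comp_index(2)[OF f(2) h(2)] unfolding succeeds_def by blast
    with \<psi>'(1) show ?thesis by blast
  qed
  then show ?thesis by blast
qed

lemma ex_succeeds_join:
  "\<exists>b. \<forall>\<psi> \<psi>' g. succeeds cnt k \<psi> A g \<longrightarrow> succeeds cnt l \<psi>' B g \<longrightarrow>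
    succeeds cnt b (join_learner \<psi> \<psi>') (A \<otimes> B) g"
proof -
  obtain b where b: "\<And>v u F n. \<forall>n. cnt v n \<le> k \<Longrightarrow> \<forall>i n. cnt (u i) n \<le> l \<Longrightarrow>
      cnt (\<lambda>n. F (v n) (u (v n) n)) n \<le> b"
    using ex_cnt_bind[of k l] by blast
  have "succeeds cnt b (join_learner \<psi> \<psi>') (A \<otimes> B) g"
    if \<psi>: "succeeds cnt k \<psi> A g" and \<psi>': "succeeds cnt l \<psi>' B g" for \<psi> \<psi>' g
  proof -
    from \<psi> obtain i f where f: "f \<in> A" "Phi i g = Some f"
      and i: "\<forall>\<^sub>F n in sequentially. \<psi> (restr g n) = i" and k: "\<forall>n. cnt (\<lambda>n. \<psi> (restr g n)) n \<le> k"
      unfolding succeeds_def by blast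
    from \<psi>' obtain j h where h: "h \<in> B" "Phi j g = Some h"
      and j: "\<forall>\<^sub>F n in sequentially. \<psi>' (restr g n) = j" and l: "\<forall>n. cnt (\<lambda>n. \<psi>' (restr g n)) n \<le> l"
      unfolding succeeds_def by blast
    have "cnt (\<lambda>n. join_learner \<psi> \<psi>' (restr g n)) n \<le> b" for n
      unfolding join_learner_def
      using b[OF k, of "\<lambda>_ n. \<psi>' (restr g n)" "\<lambda>i j. join_index (pair i j)" n] l by simp
    moreover from i j have "\<forall>\<^sub>F n in sequentially. join_learner \<psi> \<psi>' (restr g n) = join_index (pair i j)"
      by eventually_elim (simp add: join_learner_def)
    moreover have "f \<oplus> h \<in> A \<otimes> B" using f(1) h(1) unfolding joins_def by blast
    ultimately show ?thesis
      using join_index(2)[OF f(2) h(2)] unfolding succeeds_def by blast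
  qed
  then show ?thesis by blast
qed

lemma succeeds_const: "Phi i g = Some f \<Longrightarrow> f \<in> A \<Longrightarrow> succeeds cnt 1 (\<lambda>_. i) A g"
  unfolding succeeds_def using cnt_const by auto

end

text \<open>\<open>L\<close> supplies the single learners and \<open>K\<close> the families allowed
  in one reduction. \<open>K_closed\<close> keeps the pairwise combinations of two allowed families
  inside an allowed family, as transitivity and joins require.\<close>

locale reduction_notion = counter +
  fixes L :: "(nat list \<Rightarrow> nat) set" and K :: "(nat list \<Rightarrow> nat) set set"
  assumes K_const: "\<exists>S\<in>K. (\<lambda>_. i) \<in> S"
    and comp_closed: "\<psi> \<in> L \<Longrightarrow> \<psi>' \<in> L \<Longrightarrow> comp_learner \<psi> (cap cnt k \<psi>') \<in> L"
    and join_closed: "\<psi> \<in> L \<Longrightarrow> \<psi>' \<in> L \<Longrightarrow> join_learner \<psi> \<psi>' \<in> L"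
    and K_closed: "S \<in> K \<Longrightarrow> S' \<in> K \<Longrightarrow> (\<And>\<psi> \<psi>'. \<psi> \<in> L \<Longrightarrow> \<psi>' \<in> L \<Longrightarrow> F \<psi> \<psi>' \<in> L) \<Longrightarrow>
      \<exists>S''\<in>K. \<forall>\<psi>\<in>S. \<forall>\<psi>'\<in>S'. F \<psi> \<psi>' \<in> S''"
begin

lemma red_recursive:
  assumes "recursive F" "\<And>g. g \<in> B \<Longrightarrow> F g \<in> A"
  shows "red K cnt A B"
proof -
  obtain e where "\<And>g. Phi e g = Some (F g)" using recursive_imp_Phi[OF assms(1)] by blast
  with assms(2) have "succeeds cnt 1 (\<lambda>_. e) A g" if "g \<in> B" for g
    using that by (intro succeeds_const) auto
  with K_const[of e] show ?thesis unfolding red_def by blast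
qed

lemma red_refl: "red K cnt A A"
  by (rule red_recursive[of "\<lambda>g x. g x"]) (auto intro: recursive_intros)

lemma red_joins: "red K cnt A (A \<otimes> B)" "red K cnt B (A \<otimes> B)"
proof -
  show "red K cnt A (A \<otimes> B)"
    by (rule red_recursive[of "\<lambda>g x. pfst (g x)"]) (auto simp: joins_def intro!: recursive_intros)
  show "red K cnt B (A \<otimes> B)"
    by (rule red_recursive[of "\<lambda>g x. psnd (g x)"]) (auto simp: joins_def intro!: recursive_intros)
qed

lemma red_trans:
  assumes "red K cnt A B" "red K cnt B C"
  shows "red K cnt A C"
proof -
  from assms obtain S S' k l where S: "S \<in> K" "\<And>g. g \<in> C \<Longrightarrow> \<exists>\<psi>\<in>S. succeeds cnt k \<psi> B g"
    and S': "S' \<in> K" "\<forall>f\<in>B. \<exists>\<psi>'\<in>S'. succeeds cnt l \<psi>' A f"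
    unfolding red_def by meson
  obtain b where b: "\<And>\<psi> g. succeeds cnt k \<psi> B g \<Longrightarrow>
      \<exists>\<psi>'\<in>S'. succeeds cnt b (comp_learner \<psi> (cap cnt l \<psi>')) A g"
    using ex_succeeds_comp[OF S'(2), of k] by blast
  from K_closed[where F = "\<lambda>\<psi> \<psi>'. comp_learner \<psi> (cap cnt l \<psi>')", OF S(1) S'(1) comp_closed]
  obtain S'' where S'': "S'' \<in> K" "\<forall>\<psi>\<in>S. \<forall>\<psi>'\<in>S'. comp_learner \<psi> (cap cnt l \<psi>') \<in> S''"
    by (rule bexE)
  have "\<exists>\<psi>\<in>S''. succeeds cnt b \<psi> A g" if "g \<in> C" for g
    using S(2)[OF that] b S''(2) by blast
  with S''(1) show ?thesis unfolding red_def by blast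
qed

lemma red_joins_least:
  assumes "red K cnt A C" "red K cnt B C"
  shows "red K cnt (A \<otimes> B) C"
proof -
  from assms obtain S S' k l where S: "S \<in> K" "\<And>g. g \<in> C \<Longrightarrow> \<exists>\<psi>\<in>S. succeeds cnt k \<psi> A g"
    and S': "S' \<in> K" "\<And>g. g \<in> C \<Longrightarrow> \<exists>\<psi>'\<in>S'. succeeds cnt l \<psi>' B g"
    unfolding red_def by meson
  obtain b where b: "\<And>\<psi> \<psi>' g. succeeds cnt k \<psi> A g \<Longrightarrow> succeeds cnt l \<psi>' B g \<Longrightarrow>
      succeeds cnt b (join_learner \<psi> \<psi>') (A \<otimes> B) g"
    using ex_succeeds_join[of k A l B] by blast
  from K_closed[where F = join_learner, OF S(1) S'(1) join_closed]
  obtain S'' where S'': "S'' \<in> K" "\<forall>\<psi>\<in>S. \<forall>\<psi>'\<in>S'. join_learner \<psi> \<psi>' \<in> S''"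
    by (rule bexE)
  have "\<exists>\<psi>\<in>S''. succeeds cnt b \<psi> (A \<otimes> B) g" if "g \<in> C" for g
    using S(2)[OF that] S'(2)[OF that] b S''(2) by blast
  with S''(1) show ?thesis unfolding red_def by blast
qed

end


section \<open>Translation of all seven notions into the form \<open>red K cnt\<close>\<close>

section \<open>The seven notions of reducibility\<close>

text \<open>A constant learner amounts to a fixed index, so the notions with \<beta> = 1 become
  instances of learning.\<close>

definition constants :: "(nat list \<Rightarrow> nat) set" where "constants = range (\<lambda>i _. i)"
definition learners :: "(nat list \<Rightarrow> nat) set" where "learners = {\<psi>. learner \<psi>}"

definition singles :: "'a set \<Rightarrow> 'a set set" where "singles L = {{\<psi>} | \<psi>. \<psi> \<in> L}"
definition finites :: "'a set \<Rightarrow> 'a set set" where "finites L = {S. finite S \<and> S \<subseteq> L}"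

locale closed_class = counter +
  fixes L :: "(nat list \<Rightarrow> nat) set"
  assumes const_in: "(\<lambda>_. i) \<in> L"
    and comp_in: "\<psi> \<in> L \<Longrightarrow> \<psi>' \<in> L \<Longrightarrow> comp_learner \<psi> (cap cnt k \<psi>') \<in> L"
    and join_in: "\<psi> \<in> L \<Longrightarrow> \<psi>' \<in> L \<Longrightarrow> join_learner \<psi> \<psi>' \<in> L"
begin

lemma singles_notion: "reduction_notion cnt L (singles L)"
proof
  fix F :: "(nat list \<Rightarrow> nat) \<Rightarrow> (nat list \<Rightarrow> nat) \<Rightarrow> nat list \<Rightarrow> nat" and S S'
  assume "S \<in> singles L" "S' \<in> singles L" and F: "\<And>\<psi> \<psi>'. \<psi> \<in> L \<Longrightarrow> \<psi>' \<in> L \<Longrightarrow> F \<psi> \<psi>' \<in> L"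
  then obtain \<psi> \<psi>' where S: "S = {\<psi>}" "S' = {\<psi>'}" "\<psi> \<in> L" "\<psi>' \<in> L" by (auto simp: singles_def)
  show "\<exists>S''\<in>singles L. \<forall>\<psi>\<in>S. \<forall>\<psi>'\<in>S'. F \<psi> \<psi>' \<in> S''"
    by (rule bexI[of _ "{F \<psi> \<psi>'}"]) (use S F in \<open>auto simp: singles_def\<close>)
qed (auto simp: singles_def intro: const_in comp_in join_in)

lemma finites_notion: "reduction_notion cnt L (finites L)"
proof
  fix i
  show "\<exists>S\<in>finites L. (\<lambda>_. i) \<in> S"
    by (rule bexI[of _ "{\<lambda>_. i}"]) (auto simp: finites_def const_in)
next
  fix F :: "(nat list \<Rightarrow> nat) \<Rightarrow> (nat list \<Rightarrow> nat) \<Rightarrow> nat list \<Rightarrow> nat" and S S'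
  assume S: "S \<in> finites L" "S' \<in> finites L" and F: "\<And>\<psi> \<psi>'. \<psi> \<in> L \<Longrightarrow> \<psi>' \<in> L \<Longrightarrow> F \<psi> \<psi>' \<in> L"
  have "(\<lambda>(\<psi>, \<psi>'). F \<psi> \<psi>') ` (S \<times> S') \<in> finites L"
    using S F by (auto simp: finites_def)
  then show "\<exists>S''\<in>finites L. \<forall>\<psi>\<in>S. \<forall>\<psi>'\<in>S'. F \<psi> \<psi>' \<in> S''"
    by (rule bexI[rotated]) auto
qed (auto intro: comp_in join_in)

lemma whole_notion: "reduction_notion cnt L {L}"
  by unfold_locales (auto intro: const_in comp_in join_in)

end

lemma constants_closed: "closed_class (\<lambda>_ _. 0) constants"
  by unfold_locales (auto simp: constants_def comp_learner_def join_learner_def cap_def fun_eq_iff)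

lemma (in counter) learners_closed: "closed_class cnt learners"
proof
  fix i
  show "(\<lambda>_. i) \<in> learners" unfolding learners_def learner_iff by (simp add: recursive_const)
next
  fix \<psi> \<psi>' k
  assume "\<psi> \<in> learners" "\<psi>' \<in> learners"
  then have "learner \<psi>" "learner \<psi>'" by (auto simp: learners_def)
  then have "learner (comp_learner \<psi> (cap cnt k \<psi>'))"
    unfolding learner_iff[of "comp_learner \<psi> _"] comp_learner_def
    by (intro recursive_comp[OF comp_index(1)] recursive_intros recursive_cap recursive_learner)
  moreover have "learner (join_learner \<psi> \<psi>')"
    using \<open>learner \<psi>\<close> \<open>learner \<psi>'\<close> unfolding learner_iff[of "join_learner \<psi> _"] join_learner_def
    by (intro recursive_comp[OF join_index(1)] recursive_intros recursive_learner)
  ultimately show "comp_learner \<psi> (cap cnt k \<psi>') \<in> learners" "join_learner \<psi> \<psi>' \<in> learners"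
    by (simp_all add: learners_def)
qed

interpretation medvedev: reduction_notion "\<lambda>_ _. 0" constants "singles constants"
  by (rule closed_class.singles_notion[OF constants_closed])
interpretation muchnik: reduction_notion "\<lambda>_ _. 0" constants "{constants}"
  by (rule closed_class.whole_notion[OF constants_closed])
interpretation fin_1: reduction_notion "\<lambda>_ _. 0" constants "finites constants"
  by (rule closed_class.finites_notion[OF constants_closed])
interpretation one_omega: reduction_notion "\<lambda>_ _. 0" learners "singles learners"
  by (rule closed_class.singles_notion[OF zero.learners_closed])
interpretation fin_omega: reduction_notion "\<lambda>_ _. 0" learners "finites learners"
  by (rule closed_class.finites_notion[OF zero.learners_closed])
interpretation one_fin: reduction_notion mind_changes learners "singles learners"
  by (rule closed_class.singles_notion[OF mind_changes.learners_closed])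
interpretation one_omega_fin: reduction_notion hypotheses learners "singles learners"
  by (rule closed_class.singles_notion[OF hypotheses.learners_closed])

text \<open>The condition on \<open>\<Gamma>\<close> concerns each point of its domain separately
  once \<open>w\<close> is fixed. Hence the domain can be cut down to \<open>B\<close> and the
  values chosen point by point.\<close>

lemma reducible_pointwise:
  assumes "\<And>\<Gamma>. C \<Gamma> \<longleftrightarrow> (\<exists>w. W w \<and> (\<forall>g\<in>dom \<Gamma>. Q w (\<Gamma> g) g))"
  shows "reducible C A B \<longleftrightarrow> (\<exists>w. W w \<and> (\<forall>g\<in>B. \<exists>f\<in>A. Q w (Some f) g))"
proof
  assume "reducible C A B"
  then obtain \<Gamma> w where "W w" "\<forall>g\<in>dom \<Gamma>. Q w (\<Gamma> g) g" "B \<subseteq> dom \<Gamma>" "\<forall>g\<in>B. the (\<Gamma> g) \<in> A"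
    unfolding reducible_def assms by blast
  then show "\<exists>w. W w \<and> (\<forall>g\<in>B. \<exists>f\<in>A. Q w (Some f) g)"
    by (intro exI[of _ w]) (metis domD option.sel subsetD)
next
  assume "\<exists>w. W w \<and> (\<forall>g\<in>B. \<exists>f\<in>A. Q w (Some f) g)"
  then obtain w F where w: "W w" "\<And>g. g \<in> B \<Longrightarrow> F g \<in> A \<and> Q w (Some (F g)) g" by metis
  define \<Gamma> where "\<Gamma> g = (if g \<in> B then Some (F g) else None)" for g
  have "C \<Gamma>" unfolding assms using w by (auto simp: \<Gamma>_def dom_def)
  moreover have "B \<subseteq> dom \<Gamma>" "\<forall>g\<in>B. the (\<Gamma> g) \<in> A" using w by (auto simp: \<Gamma>_def)
  ultimately show "reducible C A B" unfolding reducible_def by blast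
qed

text \<open>A finite subset of an increasing union already lies in one of its members, so the bound
  passes to the union.\<close>

lemma bounded_card_iff:
  fixes X :: "nat \<Rightarrow> 'a set"
  assumes mono: "\<And>m n. m \<le> n \<Longrightarrow> X m \<subseteq> X n" and fin: "\<And>n. finite (X n)"
  shows "(\<forall>n. card (X n) \<le> k) \<longleftrightarrow> finite (\<Union>n. X n) \<and> card (\<Union>n. X n) \<le> k"
proof
  assume k: "\<forall>n. card (X n) \<le> k"
  have "card G \<le> k" if "finite G" "G \<subseteq> (\<Union>n. X n)" for G
  proof -
    have "\<exists>n. G \<subseteq> X n"
      using that
    proof (induction G rule: finite_induct)
      case (insert x G)
      then obtain m n where "x \<in> X m" "G \<subseteq> X n" by auto
      moreover have "X m \<subseteq> X (max m n)" by (rule mono) simp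
      moreover have "X n \<subseteq> X (max m n)" by (rule mono) simp
      ultimately have "insert x G \<subseteq> X (max m n)" by blast
      then show ?case by blast
    qed simp
    then show ?thesis using k fin by (meson card_mono le_trans)
  qed
  then show "finite (\<Union>n. X n) \<and> card (\<Union>n. X n) \<le> k"
    using finite_if_finite_subsets_card_bdd by metis
next
  assume "finite (\<Union>n. X n) \<and> card (\<Union>n. X n) \<le> k"
  then show "\<forall>n. card (X n) \<le> k" by (meson UN_upper UNIV_I card_mono le_trans)
qed

lemma mind_changes_le_iff: "(\<forall>n. mind_changes v n \<le> k) \<longleftrightarrow>
    finite {n. v (n + 1) \<noteq> v n} \<and> card {n. v (n + 1) \<noteq> v n} \<le> k"
proof -
  have "(\<Union>n. {j. j < n \<and> v (Suc j) \<noteq> v j}) = {n. v (n + 1) \<noteq> v n}" by auto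
  then show ?thesis
    using bounded_card_iff[of "\<lambda>n. {j. j < n \<and> v (Suc j) \<noteq> v j}" k]
    by (simp add: mind_changes_eq_card) (auto dest: less_le_trans)
qed

lemma hypotheses_le_iff: "(\<forall>n. hypotheses v n \<le> k) \<longleftrightarrow> finite (range v) \<and> card (range v) \<le> k"
proof -
  have "(\<Union>n. v ` {..n}) = range v" by auto
  then show ?thesis
    using bounded_card_iff[of "\<lambda>n. v ` {..n}" k] by (auto simp: hypotheses_def image_mono)
qed

lemma succeeds_const_iff: "succeeds (\<lambda>_ _. 0) k (\<lambda>_. e) A g \<longleftrightarrow> (\<exists>f\<in>A. Phi e g = Some f)"
  by (auto simp: succeeds_def)

text \<open>Here \<open>\<Gamma>\<close> is a complete functional \<open>Phi e\<close> whose domain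
  may exceed \<open>B\<close>, so the pointwise criterion does not apply and the index is
  transferred directly.\<close>

lemma reducible_1_1: "reducible computable_1_1 = red (singles constants) (\<lambda>_ _. 0)"
proof (intro ext iffI)
  fix A B assume "reducible computable_1_1 A B"
  then obtain e where "B \<subseteq> dom (Phi e)" "\<forall>g\<in>B. the (Phi e g) \<in> A"
    unfolding reducible_def computable_1_1_def by blast
  then have "\<forall>g\<in>B. \<exists>f\<in>A. Phi e g = Some f" by (metis domD option.sel subsetD)
  then show "red (singles constants) (\<lambda>_ _. 0) A B"
    unfolding red_def singles_def constants_def using succeeds_const_iff by blast
next
  fix A B assume "red (singles constants) (\<lambda>_ _. 0) A B"
  then obtain e where e: "\<forall>g\<in>B. \<exists>f\<in>A. Phi e g = Some f"
    unfolding red_def singles_def constants_def using succeeds_const_iff by auto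
  then have "B \<subseteq> dom (Phi e)" "\<forall>g\<in>B. the (Phi e g) \<in> A" by force+
  then show "reducible computable_1_1 A B"
    unfolding reducible_def computable_1_1_def by blast
qed

lemma red_single_learners: "red (singles learners) cnt A B \<longleftrightarrow>
    (\<exists>\<psi> k. learner \<psi> \<and> (\<forall>g\<in>B. succeeds cnt k \<psi> A g))"
  unfolding red_def singles_def learners_def by blast

lemma reducible_1_omega: "reducible computable_1_omega = red (singles learners) (\<lambda>_ _. 0)"
proof (intro ext)
  fix A B
  have "reducible computable_1_omega A B \<longleftrightarrow> (\<exists>\<psi>. learner \<psi> \<and> (\<forall>g\<in>B. \<exists>f\<in>A.
      \<exists>i. (\<forall>\<^sub>F n in sequentially. \<psi> (restr g n) = i) \<and> Phi i g = Some f))"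
    by (rule reducible_pointwise) (simp add: computable_1_omega_def identified_def identified_on_def)
  then show "reducible computable_1_omega A B = red (singles learners) (\<lambda>_ _. 0) A B"
    unfolding red_single_learners succeeds_def by simp blast
qed

lemma reducible_1_fin: "reducible computable_1_fin = red (singles learners) mind_changes"
proof (intro ext)
  fix A B
  have "reducible computable_1_fin A B \<longleftrightarrow> (\<exists>w. learner (fst w) \<and> (\<forall>g\<in>B. \<exists>f\<in>A.
      (\<exists>i. (\<forall>\<^sub>F n in sequentially. fst w (restr g n) = i) \<and> Phi i g = Some f) \<and>
      (\<forall>n. mind_changes (\<lambda>n. fst w (restr g n)) n \<le> snd w)))"
    by (rule reducible_pointwise)
      (unfold computable_1_fin_def identified_def identified_on_def mind_changes_le_iff ball_conj_distrib
        split_paired_Ex fst_conv snd_conv, blast)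
  then show "reducible computable_1_fin A B = red (singles learners) mind_changes A B"
    unfolding red_single_learners succeeds_def by simp blast
qed

lemma reducible_1_omega_fin: "reducible computable_1_omega_fin = red (singles learners) hypotheses"
proof (intro ext)
  fix A B
  have "reducible computable_1_omega_fin A B \<longleftrightarrow> (\<exists>w. learner (fst w) \<and> (\<forall>g\<in>B. \<exists>f\<in>A.
      (\<exists>i. (\<forall>\<^sub>F n in sequentially. fst w (restr g n) = i) \<and> Phi i g = Some f) \<and>
      (\<forall>n. hypotheses (\<lambda>n. fst w (restr g n)) n \<le> snd w)))"
    by (rule reducible_pointwise)
      (unfold computable_1_omega_fin_def identified_def identified_on_def hypotheses_le_iff ball_conj_distrib
        split_paired_Ex fst_conv snd_conv, blast)
  then show "reducible computable_1_omega_fin A B = red (singles learners) hypotheses A B"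
    unfolding red_single_learners succeeds_def by simp blast
qed

lemma reducible_omega_1: "reducible computable_omega_1 = red {constants} (\<lambda>_ _. 0)"
proof (intro ext)
  fix A B
  have "reducible computable_omega_1 A B \<longleftrightarrow> (\<exists>w::unit. True \<and> (\<forall>g\<in>B. \<exists>f\<in>A. turing_le (the (Some f)) g))"
    by (rule reducible_pointwise) (simp add: computable_omega_1_def)
  also have "\<dots> \<longleftrightarrow> red {constants} (\<lambda>_ _. 0) A B"
    unfolding red_def constants_def by (simp add: succeeds_const_iff turing_le_def) blast
  finally show "reducible computable_omega_1 A B = red {constants} (\<lambda>_ _. 0) A B" .
qed

lemma reducible_fin_1: "reducible computable_fin_1 = red (finites constants) (\<lambda>_ _. 0)"
proof (intro ext iffI)
  fix A B
  have red: "reducible computable_fin_1 A B \<longleftrightarrow> (\<exists>b. True \<and> (\<forall>g\<in>B. \<exists>f\<in>A. \<exists>e<b. Some f = Phi e g))"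
    by (rule reducible_pointwise) (simp add: computable_fin_1_def)
  {
    assume "reducible computable_fin_1 A B"
    then obtain b where b: "\<forall>g\<in>B. \<exists>f\<in>A. \<exists>e<b. Some f = Phi e g" unfolding red by blast
    show "red (finites constants) (\<lambda>_ _. 0) A B"
      unfolding red_def
    proof (rule bexI[of _ "(\<lambda>e _. e) ` {..<b}"], rule exI[of _ 0], rule ballI)
      show "(\<lambda>e _. e) ` {..<b} \<in> finites constants" by (auto simp: finites_def constants_def)
      fix g assume "g \<in> B"
      then obtain f e where "f \<in> A" "e < b" "Some f = Phi e g" using b by blast
      then have "succeeds (\<lambda>_ _. 0) 0 (\<lambda>_. e) A g" unfolding succeeds_const_iff by metis
      with \<open>e < b\<close> show "\<exists>\<psi>\<in>(\<lambda>e _. e) ` {..<b}. succeeds (\<lambda>_ _. 0) 0 \<psi> A g" by blast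
    qed
  }
  assume "red (finites constants) (\<lambda>_ _. 0) A B"
  then obtain S k where S: "finite S" "S \<subseteq> constants" "\<forall>g\<in>B. \<exists>\<psi>\<in>S. succeeds (\<lambda>_ _. 0) k \<psi> A g"
    unfolding red_def finites_def by blast
  obtain I where "finite I" and I: "S = (\<lambda>i _. i) ` I"
    using finite_subset_image[OF S(1) S(2)[unfolded constants_def]] by blast
  then obtain b where "\<forall>i\<in>I. i < b" using finite_nat_set_iff_bounded by blast
  then have "\<forall>g\<in>B. \<exists>f\<in>A. \<exists>e<b. Some f = Phi e g"
    using S(3) I by (fastforce simp: succeeds_const_iff)
  then show "reducible computable_fin_1 A B" unfolding red by blast
qed

lemma succeeds_zero_iff: "succeeds (\<lambda>_ _. 0) k \<psi> A g \<longleftrightarrow>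
    (\<exists>i. \<exists>f\<in>A. (\<forall>\<^sub>F n in sequentially. \<psi> (restr g n) = i) \<and> Phi i g = Some f)"
  by (simp add: succeeds_def)

lemma reducible_fin_omega: "reducible computable_fin_omega = red (finites learners) (\<lambda>_ _. 0)"
proof (intro ext iffI)
  fix A B
  have red: "reducible computable_fin_omega A B \<longleftrightarrow> (\<exists>b. True \<and> (\<forall>g\<in>B. \<exists>f\<in>A. \<exists>e<b. \<exists>\<psi>. Psi e = Some \<psi> \<and>
      (\<exists>i. (\<forall>\<^sub>F n in sequentially. \<psi> (restr g n) = i) \<and> Phi i g = Some f)))"
    by (rule reducible_pointwise) (simp add: computable_fin_omega_def identified_on_def)
  {
    assume "reducible computable_fin_omega A B"
    then obtain b where b: "\<forall>g\<in>B. \<exists>f\<in>A. \<exists>e<b. \<exists>\<psi>. Psi e = Some \<psi> \<and>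
      (\<exists>i. (\<forall>\<^sub>F n in sequentially. \<psi> (restr g n) = i) \<and> Phi i g = Some f)" unfolding red by blast
    show "red (finites learners) (\<lambda>_ _. 0) A B"
      unfolding red_def
    proof (rule bexI[of _ "{\<psi>. \<exists>e<b. Psi e = Some \<psi>}"], rule exI[of _ 0], rule ballI)
      have "{\<psi>. \<exists>e<b. Psi e = Some \<psi>} \<subseteq> (\<lambda>e. the (Psi e)) ` {..<b}" by force
      then have "finite {\<psi>. \<exists>e<b. Psi e = Some \<psi>}" by (rule finite_subset) simp
      then show "{\<psi>. \<exists>e<b. Psi e = Some \<psi>} \<in> finites learners"
        by (auto simp: finites_def learners_def learner_def)
      fix g assume "g \<in> B"
      then show "\<exists>\<psi>\<in>{\<psi>. \<exists>e<b. Psi e = Some \<psi>}. succeeds (\<lambda>_ _. 0) 0 \<psi> A g"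
        unfolding succeeds_zero_iff using b by blast
    qed
  }
  assume "red (finites learners) (\<lambda>_ _. 0) A B"
  then obtain S k where S: "finite S" "S \<subseteq> learners" "\<forall>g\<in>B. \<exists>\<psi>\<in>S. succeeds (\<lambda>_ _. 0) k \<psi> A g"
    unfolding red_def finites_def by blast
  then have "\<forall>\<psi>\<in>S. \<exists>e. Psi e = Some \<psi>" by (auto simp: learners_def learner_def)
  then obtain E where E: "\<forall>\<psi>\<in>S. Psi (E \<psi>) = Some \<psi>" by metis
  obtain b where "\<forall>i\<in>E ` S. i < b" using S(1) finite_nat_set_iff_bounded[of "E ` S"] by auto
  then have "\<forall>g\<in>B. \<exists>f\<in>A. \<exists>e<b. \<exists>\<psi>. Psi e = Some \<psi> \<and>
      (\<exists>i. (\<forall>\<^sub>F n in sequentially. \<psi> (restr g n) = i) \<and> Phi i g = Some f)"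
    using S(3) E unfolding succeeds_zero_iff by (metis imageI)
  then show "reducible computable_fin_omega A B" unfolding red by blast
qed


section \<open>The first-order property that separates the structures\<close>

section \<open>The sentence\<close>

definition fm_imp :: "fm \<Rightarrow> fm \<Rightarrow> fm" where "fm_imp \<phi> \<chi> = Neg (Conj \<phi> (Neg \<chi>))"
definition fm_ex :: "nat \<Rightarrow> fm \<Rightarrow> fm" where "fm_ex i \<phi> = Neg (All i (Neg \<phi>))"

text \<open>
  For all \<open>a\<close> and \<open>b\<close> there is a least \<open>c\<close> with \<open>b \<le> a \<squnion> c\<close>, where \<open>b \<le> a \<squnion> d\<close> is
  expressed by saying that every upper bound of \<open>a\<close> and \<open>d\<close> is above \<open>b\<close>.
\<close>

definition brouwer_fm :: fm where
  "brouwer_fm = (let \<chi> = All 4 (fm_imp (Conj (Le 0 4) (Le 3 4)) (Le 1 4)) in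
    All 0 (All 1 (fm_ex 2 (All 3 (Conj (fm_imp (Le 2 3) \<chi>) (fm_imp \<chi> (Le 2 3)))))))"

text \<open>This is the content of \<open>brouwer_fm\<close> for the preorder before passing to
  degrees. Putting \<open>d = c\<close> shows that \<open>c\<close> itself is a solution, and the
  other solutions are exactly the elements above it.\<close>

definition brouwerian :: "('a \<Rightarrow> 'a \<Rightarrow> bool) \<Rightarrow> bool" where
  "brouwerian r \<longleftrightarrow> (\<forall>a b. \<exists>c. \<forall>d. r c d \<longleftrightarrow> (\<forall>u. r a u \<and> r d u \<longrightarrow> r b u))"

lemma sentence_brouwer_fm: "sentence brouwer_fm"
  by (auto simp: sentence_def brouwer_fm_def fm_imp_def fm_ex_def Let_def)

lemma true_in_brouwer_fm:
  assumes refl: "\<And>A. reducible C A A"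
    and trans: "\<And>A B D. reducible C A B \<Longrightarrow> reducible C B D \<Longrightarrow> reducible C A D"
  shows "true_in (degrees C) (degree_le C) brouwer_fm \<longleftrightarrow> brouwerian (reducible C)"
proof -
  define deg where "deg A = {(A, B). reducible C A B \<and> reducible C B A} `` {A}" for A
  have degrees: "degrees C = range deg"
    unfolding degrees_def quotient_def deg_def by auto
  have le: "degree_le C (deg A) (deg B) \<longleftrightarrow> reducible C A B" for A B
    unfolding degree_le_def deg_def using refl trans by blast
  have imp: "sat U r v (fm_imp \<phi> \<chi>) \<longleftrightarrow> (sat U r v \<phi> \<longrightarrow> sat U r v \<chi>)"
    and ex: "sat U r v (fm_ex i \<phi>) \<longleftrightarrow> (\<exists>x\<in>U. sat U r (v(i := x)) \<phi>)"
    for U and r :: "baire set set \<Rightarrow> baire set set \<Rightarrow> bool" and v \<phi> \<chi> i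
    by (simp_all add: fm_imp_def fm_ex_def)
  have "sat (degrees C) (degree_le C) v brouwer_fm \<longleftrightarrow> brouwerian (reducible C)" for v
    by (simp add: brouwer_fm_def imp ex Let_def degrees le brouwerian_def iff_conv_conj_imp[of "reducible C _ _"])
  \<comment> \<open>Truth quantifies over all valuations in the universe; exhibiting one rules out
    vacuous truth.\<close>
  moreover have "range (\<lambda>_. deg {}) \<subseteq> degrees C" by (auto simp: degrees)
  ultimately show ?thesis unfolding true_in_def by blast
qed


section \<open>Explicit least solutions for (1,1), (1,\<omega>) and (\<omega>,1)\<close>

section \<open>The Brouwerian degree structures\<close>

text \<open>The product \<open>A \<otimes> D\<close> is a least upper bound, so the condition on all
  common upper bounds becomes a single reduction.\<close>

lemma (in reduction_notion) brouwerian_iff: "brouwerian (red K cnt) \<longleftrightarrow>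
    (\<forall>A B. \<exists>C. red K cnt B (A \<otimes> C) \<and> (\<forall>D. red K cnt B (A \<otimes> D) \<longrightarrow> red K cnt C D))"
proof
  assume br: "brouwerian (red K cnt)"
  show "\<forall>A B. \<exists>C. red K cnt B (A \<otimes> C) \<and> (\<forall>D. red K cnt B (A \<otimes> D) \<longrightarrow> red K cnt C D)"
  proof (intro allI)
    fix A B
    obtain C where C: "\<And>D. red K cnt C D \<longleftrightarrow> (\<forall>U. red K cnt A U \<and> red K cnt D U \<longrightarrow> red K cnt B U)"
      using br unfolding brouwerian_def by metis
    have "red K cnt B (A \<otimes> C)" using C[of C] red_refl red_joins by blast
    moreover have "red K cnt C D" if "red K cnt B (A \<otimes> D)" for D
      using C[of D] that red_trans red_joins_least by blast
    ultimately show "\<exists>C. red K cnt B (A \<otimes> C) \<and> (\<forall>D. red K cnt B (A \<otimes> D) \<longrightarrow> red K cnt C D)" by blast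
  qed
next
  assume *: "\<forall>A B. \<exists>C. red K cnt B (A \<otimes> C) \<and> (\<forall>D. red K cnt B (A \<otimes> D) \<longrightarrow> red K cnt C D)"
  show "brouwerian (red K cnt)"
    unfolding brouwerian_def
  proof (intro allI)
    fix A B
    obtain C where C: "red K cnt B (A \<otimes> C)" "\<And>D. red K cnt B (A \<otimes> D) \<Longrightarrow> red K cnt C D" using * by blast
    have "red K cnt C D \<longleftrightarrow> (\<forall>U. red K cnt A U \<and> red K cnt D U \<longrightarrow> red K cnt B U)" for D
    proof
      assume "red K cnt C D"
      then show "\<forall>U. red K cnt A U \<and> red K cnt D U \<longrightarrow> red K cnt B U"
        using C(1) red_trans red_joins_least by blast
    next
      assume "\<forall>U. red K cnt A U \<and> red K cnt D U \<longrightarrow> red K cnt B U"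
      then show "red K cnt C D" using C(2) red_joins by blast
    qed
    then show "\<exists>C. \<forall>D. red K cnt C D \<longleftrightarrow> (\<forall>U. red K cnt A U \<and> red K cnt D U \<longrightarrow> red K cnt B U)" by blast
  qed
qed

text \<open>Indices may vary from point to point, so nothing has to be stored: every solution
  \<open>D\<close> is a subset of the set \<open>?C\<close> of all individually suitable
  \<open>f\<close>.\<close>

lemma brouwerian_muchnik: "brouwerian (red {constants} (\<lambda>_ _. 0))"
  unfolding muchnik.brouwerian_iff
proof (intro allI exI conjI impI)
  have red: "red {constants} (\<lambda>_ _. 0) A B \<longleftrightarrow> (\<forall>g\<in>B. \<exists>f\<in>A. turing_le f g)" for A B
    unfolding red_def constants_def by (simp add: succeeds_const_iff turing_le_def) blast
  fix A B
  let ?C = "{f. \<forall>g\<in>A. \<exists>h\<in>B. turing_le h (g \<oplus> f)}"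
  show "red {constants} (\<lambda>_ _. 0) B (A \<otimes> ?C)" by (auto simp: red joins_def)
  fix D assume "red {constants} (\<lambda>_ _. 0) B (A \<otimes> D)"
  then have "D \<subseteq> ?C" by (auto simp: red joins_def)
  then show "red {constants} (\<lambda>_ _. 0) ?C D" unfolding red using turing_le_refl by blast
qed

lemma ex_drop_index: "\<exists>t. \<forall>g p f. Phi t (g \<oplus> (p \<oplus> f)) = Some (g \<oplus> f)"
proof -
  have "recursive (\<lambda>G x. pair (pfst (G x)) (psnd (psnd (G x))))" by (intro recursive_intros)
  from recursive_imp_Phi[OF this] obtain t where
    "Phi t G = Some (\<lambda>x. pair (pfst (G x)) (psnd (psnd (G x))))" for G by blast
  then show ?thesis by (intro exI[of _ t]) (simp add: join_def fun_eq_iff)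
qed

lemma brouwerian_medvedev: "brouwerian (red (singles constants) (\<lambda>_ _. 0))"
  unfolding medvedev.brouwerian_iff
proof (intro allI exI conjI impI)
  have red: "red (singles constants) (\<lambda>_ _. 0) A B \<longleftrightarrow> (\<exists>e. \<forall>g\<in>B. \<exists>f\<in>A. Phi e g = Some f)" for A B
  proof -
    have "red (singles constants) (\<lambda>_ _. 0) A B \<longleftrightarrow>
        (\<exists>\<psi>\<in>constants. \<exists>k. \<forall>g\<in>B. succeeds (\<lambda>_ _. 0) k \<psi> A g)"
      unfolding red_def singles_def by blast
    then show ?thesis by (simp add: constants_def succeeds_const_iff)
  qed
  fix A B
  let ?C = "{(\<lambda>_. e) \<oplus> f | e f. \<forall>g\<in>A. \<exists>h\<in>B. Phi e (g \<oplus> f) = Some h}"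
  obtain t where t: "\<And>g p f. Phi t (g \<oplus> (p \<oplus> f)) = Some (g \<oplus> f)" using ex_drop_index by blast
  \<comment> \<open>For \<open>G = g \<oplus> ((\<lambda>_. e) \<oplus> f)\<close> the expression
    \<open>pfst (psnd (G 0))\<close> is the stored index \<open>e\<close>, which expects
    \<open>g \<oplus> f\<close>; the index \<open>t\<close> removes the label first.\<close>
  have "recursive (\<lambda>G x. comp_index (pair t (pfst (psnd (G 0)))))"
    by (intro recursive_comp[OF comp_index(1)] recursive_intros)
  from ex_universal[OF this] obtain v where
    v: "\<And>G h. Phi (comp_index (pair t (pfst (psnd (G 0))))) G = Some h \<Longrightarrow> Phi v G = Some h" by blast
  have "\<exists>h\<in>B. Phi v G = Some h" if G: "G \<in> A \<otimes> ?C" for G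
  proof -
    from G obtain g e f where G: "G = g \<oplus> ((\<lambda>_. e) \<oplus> f)" "g \<in> A" "\<forall>g\<in>A. \<exists>h\<in>B. Phi e (g \<oplus> f) = Some h"
      unfolding joins_def by blast
    then obtain h where h: "h \<in> B" "Phi e (g \<oplus> f) = Some h" by blast
    have "Phi v G = Some h"
      using comp_index(2)[OF t h(2), of "\<lambda>_. e"] by (intro v) (simp add: G(1))
    with h(1) show ?thesis by blast
  qed
  then show "red (singles constants) (\<lambda>_ _. 0) B (A \<otimes> ?C)" unfolding red by blast
  fix D assume "red (singles constants) (\<lambda>_ _. 0) B (A \<otimes> D)"
  then obtain e where e: "\<forall>g\<in>A \<otimes> D. \<exists>h\<in>B. Phi e g = Some h" unfolding red by blast
  show "red (singles constants) (\<lambda>_ _. 0) ?C D"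
  proof (rule medvedev.red_recursive)
    show "recursive (\<lambda>f. (\<lambda>_. e) \<oplus> f)" by (intro recursive_intros)
    fix f assume "f \<in> D"
    with e show "(\<lambda>_. e) \<oplus> f \<in> ?C" unfolding joins_def by blast
  qed
qed

text \<open>
  An element \<open>p \<oplus> f\<close> of the least solution carries a learner, given by its table \<open>p\<close>. The learner
  below consults the part of the table that it has seen.
\<close>

definition table_learner :: "nat list \<Rightarrow> nat" where
  "table_learner \<sigma> = (let l = (\<lambda>m. lookup (list_encode \<sigma>) (list_encode
      (map (\<lambda>x. pair (pfst (lookup (list_encode \<sigma>) x - 1)) (psnd (psnd (lookup (list_encode \<sigma>) x - 1)))) [0..<m])))
    in rec_nat 0 (\<lambda>m y. if l m = 0 then y else pfst (psnd (l m - 1))) (length \<sigma>))"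

lemma learner_table_learner: "learner table_learner"
  unfolding learner_iff table_learner_def Let_def by (intro recursive_intros)

text \<open>A prefix of length \<open>n\<close> shows the table entry for the \<open>m\<close>-th
  segment only if the code of that segment is below \<open>n\<close>. The learner keeps the last
  visible entry. Once the entry for \<open>M\<close> is visible, it and all later visible ones equal
  \<open>i\<close>.\<close>

lemma table_learner_limit:
  assumes "\<forall>\<^sub>F n in sequentially. p (rcode (g \<oplus> f) n) = i"
  shows "\<forall>\<^sub>F n in sequentially. table_learner (restr (g \<oplus> (p \<oplus> f)) n) = i"
proof -
  obtain M where M: "\<And>m. m \<ge> M \<Longrightarrow> p (rcode (g \<oplus> f) m) = i"
    using assms unfolding eventually_sequentially by blast
  have "table_learner (restr (g \<oplus> (p \<oplus> f)) n) = i" if n: "n > M" "n > rcode (g \<oplus> f) M" for n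
  proof -
    define l where "l m = lookup (rcode (g \<oplus> (p \<oplus> f)) n) (list_encode
      (map (\<lambda>x. pair (pfst (lookup (rcode (g \<oplus> (p \<oplus> f)) n) x - 1))
        (psnd (psnd (lookup (rcode (g \<oplus> (p \<oplus> f)) n) x - 1)))) [0..<m]))" for m
    have l: "l m = (if rcode (g \<oplus> f) m < n then Suc ((g \<oplus> (p \<oplus> f)) (rcode (g \<oplus> f) m)) else 0)"
      if "m \<le> n" for m
    proof -
      have "map (\<lambda>x. pair (pfst (lookup (rcode (g \<oplus> (p \<oplus> f)) n) x - 1))
        (psnd (psnd (lookup (rcode (g \<oplus> (p \<oplus> f)) n) x - 1)))) [0..<m] = restr (g \<oplus> f) m"
        using that by (intro nth_equalityI) (auto simp: lookup_rcode join_def)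
      then show ?thesis by (simp add: l_def lookup_rcode)
    qed
    define r where "r = rec_nat 0 (\<lambda>m y. if l m = 0 then y else pfst (psnd (l m - 1)))"
    have "r (Suc N) = i" if "M \<le> N" "N < n" for N
      using that
    proof (induction N rule: dec_induct)
      case base
      then show ?case using n M[of M] l[of M] by (simp add: r_def)
    next
      case (step N)
      then show ?case using M[of "Suc N"] l[of "Suc N"] by (simp add: r_def)
    qed
    from this[of "n - 1"] have "r n = i" using n by simp
    then show ?thesis by (simp only: table_learner_def Let_def length_restr r_def l_def)
  qed
  then show ?thesis
    unfolding eventually_sequentially
    by (intro exI[of _ "Suc (max M (rcode (g \<oplus> f) M))"]) auto
qed

lemma brouwerian_one_omega: "brouwerian (red (singles learners) (\<lambda>_ _. 0))"
  unfolding one_omega.brouwerian_iff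
proof (intro allI exI conjI impI)
  fix A B
  \<comment> \<open>Only convergence to a correct index is demanded of the table \<open>p\<close>.
    It need not be computable, since it is read from the input.\<close>
  let ?C = "{p \<oplus> f | p f. \<forall>g\<in>A. \<exists>i. \<exists>h\<in>B. (\<forall>\<^sub>F n in sequentially. p (rcode (g \<oplus> f) n) = i) \<and>
    Phi i (g \<oplus> f) = Some h}"
  obtain t where t: "\<And>g p f. Phi t (g \<oplus> (p \<oplus> f)) = Some (g \<oplus> f)" using ex_drop_index by blast
  let ?\<psi> = "\<lambda>\<sigma>. comp_index (pair t (table_learner \<sigma>))"
  have "learner ?\<psi>"
    unfolding learner_iff
    by (intro recursive_comp[OF comp_index(1)] recursive_intros recursive_learner[OF learner_table_learner])
  moreover have "succeeds (\<lambda>_ _. 0) 0 ?\<psi> B G" if G: "G \<in> A \<otimes> ?C" for G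
  proof -
    from G obtain g p f where G: "G = g \<oplus> (p \<oplus> f)" and "g \<in> A" and C: "\<forall>g\<in>A. \<exists>i. \<exists>h\<in>B.
        (\<forall>\<^sub>F n in sequentially. p (rcode (g \<oplus> f) n) = i) \<and> Phi i (g \<oplus> f) = Some h"
      unfolding joins_def by blast
    then obtain i h where h: "h \<in> B" "\<forall>\<^sub>F n in sequentially. p (rcode (g \<oplus> f) n) = i"
      "Phi i (g \<oplus> f) = Some h" by blast
    from table_learner_limit[OF h(2)] have "\<forall>\<^sub>F n in sequentially. ?\<psi> (restr G n) = comp_index (pair t i)"
      unfolding G by eventually_elim simp
    moreover have "Phi (comp_index (pair t i)) G = Some h" unfolding G by (rule comp_index(2)[OF t h(3)])
    ultimately show ?thesis using h(1) unfolding succeeds_zero_iff by blast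
  qed
  ultimately show "red (singles learners) (\<lambda>_ _. 0) B (A \<otimes> ?C)" unfolding red_single_learners by blast
  fix D assume "red (singles learners) (\<lambda>_ _. 0) B (A \<otimes> D)"
  then obtain \<psi> k where \<psi>: "learner \<psi>" "\<forall>G\<in>A \<otimes> D. succeeds (\<lambda>_ _. 0) k \<psi> B G"
    unfolding red_single_learners by blast
  show "red (singles learners) (\<lambda>_ _. 0) ?C D"
  proof (rule one_omega.red_recursive)
    show "recursive (\<lambda>f. (\<lambda>c. \<psi> (list_decode c)) \<oplus> f)"
      using \<psi>(1) unfolding learner_iff by (intro recursive_intros)
    fix f assume f: "f \<in> D"
    have "\<exists>i. \<exists>h\<in>B. (\<forall>\<^sub>F n in sequentially. \<psi> (list_decode (rcode (g \<oplus> f) n)) = i) \<and> Phi i (g \<oplus> f) = Some h"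
      if "g \<in> A" for g
    proof -
      have "g \<oplus> f \<in> A \<otimes> D" using f that unfolding joins_def by blast
      with \<psi>(2) show ?thesis unfolding succeeds_zero_iff by simp
    qed
    then show "(\<lambda>c. \<psi> (list_decode c)) \<oplus> f \<in> ?C" by blast
  qed
qed


section \<open>Turing independence and diagonalisation against the bounded notions\<close>

section \<open>An independent family\<close>

text \<open>The finite extension method: a condition is a length together with a function that
  matters only below it. Each requirement is forced by extending the condition, and the lengths grow
  strictly, so the conditions determine \<open>Z\<close>.\<close>

lemma ex_generic:
  assumes dense: "\<And>q n Y. \<exists>n' Y'. (\<forall>x<n. Y' x = Y x) \<and> (\<forall>Z. (\<forall>x<n'. Z x = Y' x) \<longrightarrow> Q q Z)"
  shows "\<exists>Z::nat \<Rightarrow> 'a. \<forall>q::nat. Q q Z"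
proof -
  define R where "R q s s' \<longleftrightarrow> fst s < fst s' \<and> (\<forall>x<fst s. snd s' x = snd s x) \<and>
    (\<forall>Z. (\<forall>x<fst s'. Z x = snd s' x) \<longrightarrow> Q q Z)" for q :: nat and s s' :: "nat \<times> (nat \<Rightarrow> 'a)"
  have "\<exists>s'. R q s s'" for q s
  proof -
    obtain n' Y' where "\<forall>x<fst s. Y' x = snd s x" "\<forall>Z. (\<forall>x<n'. Z x = Y' x) \<longrightarrow> Q q Z"
      using dense by blast
    then have "R q s (max n' (Suc (fst s)), Y')" by (auto simp: R_def)
    then show ?thesis ..
  qed
  then have "\<exists>s. \<forall>q. True \<and> R q (s q) (s (Suc q))" by (intro dependent_nat_choice) auto
  then obtain s where s: "R q (s q) (s (Suc q))" for q by blast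
  have less: "q < fst (s (Suc q))" for q
    by (induction q) (use s in \<open>auto simp: R_def intro: le_less_trans Suc_leI\<close>)
  have agree: "a \<le> b \<Longrightarrow> x < fst (s a) \<Longrightarrow> snd (s b) x = snd (s a) x \<and> x < fst (s b)" for a b x
  proof (induction b rule: dec_induct)
    case (step b)
    then show ?case using s[of b] by (auto simp: R_def)
  qed simp
  define Z where "Z x = snd (s (Suc x)) x" for x
  have "Z x = snd (s a) x" if "x < fst (s a)" for x a
    using agree[of "Suc x" a x] agree[of a "Suc x" x] less[of x] that unfolding Z_def
    by (metis nat_le_linear)
  then have "Q q Z" for q using s[of q] unfolding R_def by blast
  then show ?thesis by blast
qed

text \<open>The family consists of the columns of one generic function. A requirement says that
  program \<open>e\<close> does not compute column \<open>k\<close> from columns \<open>i\<close>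
  and \<open>j\<close>, and \<open>q\<close> codes these four numbers.\<close>

lemma ex_independent_family:
  "\<exists>y :: nat \<Rightarrow> baire. \<forall>k i j. turing_le (y k) (y i \<oplus> y j) \<longrightarrow> k = i \<or> k = j"
proof -
  define col where "col Z i = (\<lambda>x. Z (pair i x))" for Z :: baire and i
  define Q where "Q e k i j Z \<longleftrightarrow> (Phi e (col Z i \<oplus> col Z j) = Some (col Z k) \<longrightarrow> k = i \<or> k = j)" for e k i j Z
  have dense: "\<exists>n' Y'. (\<forall>x<n. Y' x = Y x) \<and> (\<forall>Z. (\<forall>x<n'. Z x = Y' x) \<longrightarrow> Q e k i j Z)"
    for e k i j n and Y :: baire
  proof (cases "k = i \<or> k = j")
    case True
    then show ?thesis by (auto simp: Q_def)
  next
    case ne: False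
    \<comment> \<open>The argument \<open>n\<close> is suitable because \<open>pair k n\<close> is
      at least \<open>n\<close> and so still free. If some extension yields a value \<open>v\<close>
      there, column \<open>k\<close> is given the value \<open>Suc v\<close>, which leaves columns
      \<open>i\<close> and \<open>j\<close> alone. Otherwise the program never converges at
      \<open>n\<close> on any extension.\<close>
    show ?thesis
    proof (cases "\<exists>Y' N v. (\<forall>x<n. Y' x = Y x) \<and> run e (rcode (col Y' i \<oplus> col Y' j) N) n N = Suc v")
      case True
      then obtain Y' N v where Y': "\<forall>x<n. Y' x = Y x"
        and run: "run e (rcode (col Y' i \<oplus> col Y' j) N) n N = Suc v" by blast
      define Y'' where "Y'' = Y'(pair k n := Suc v)"
      define n' where "n' = Suc (Max (insert (pair k n) (pair i ` {..N} \<union> pair j ` {..N})))"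
      have "w < n'" if "w \<in> insert (pair k n) (pair i ` {..N} \<union> pair j ` {..N})" for w
        unfolding n'_def less_Suc_eq_le using that by (intro Max_ge) auto
      then have n': "pair k n < n'" "x \<le> N \<Longrightarrow> pair i x < n'" "x \<le> N \<Longrightarrow> pair j x < n'" for x
        by blast+
      have "Q e k i j Z" if Z: "\<forall>x<n'. Z x = Y'' x" for Z
      proof -
        have "restr (col Z i \<oplus> col Z j) N = restr (col Y' i \<oplus> col Y' j) N"
          using Z n' ne by (intro restr_cong) (simp add: col_def join_def Y''_def)
        moreover have "col Z k n = Suc v" using Z n' by (simp add: col_def Y''_def)
        ultimately show ?thesis using run_sound[of e "col Z i \<oplus> col Z j" "col Z k" N n N v] run by (auto simp: Q_def)
      qed
      moreover have "\<forall>x<n. Y'' x = Y x"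
        using Y' le_prod_encode_2[of n k] by (auto simp: Y''_def)
      ultimately show ?thesis by blast
    next
      case False
      have "Q e k i j Z" if Z: "\<forall>x<n. Z x = Y x" for Z
      proof -
        have "Phi e (col Z i \<oplus> col Z j) \<noteq> Some (col Z k)"
        proof
          assume "Phi e (col Z i \<oplus> col Z j) = Some (col Z k)"
          from run_complete[OF this, of n] show False using Z False by blast
        qed
        then show ?thesis by (simp add: Q_def)
      qed
      then show ?thesis by blast
    qed
  qed
  have "\<exists>Z::baire. \<forall>q. Q (pfst (pfst q)) (psnd (pfst q)) (pfst (psnd q)) (psnd (psnd q)) Z"
    by (rule ex_generic) (rule dense)
  then obtain Z where "\<And>q. Q (pfst (pfst q)) (psnd (pfst q)) (pfst (psnd q)) (psnd (psnd q)) Z" by blast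
  from this[of "pair (pair _ _) (pair _ _)"] have "Q e k i j Z" for e k i j by simp
  then show ?thesis unfolding Q_def turing_le_def by (intro exI[of _ "col Z"]) blast
qed


section \<open>The degree structures that are not Brouwerian\<close>

text \<open>A computable \<open>x t\<close> adds nothing to the Turing degree of \<open>g t\<close>,
  but a learner reads it as a sequence of hints. The label \<open>j t\<close> is arbitrary here and
  is chosen by the later diagonalisations.\<close>

locale diagonal =
  fixes y :: "nat \<Rightarrow> baire" and x :: "nat \<Rightarrow> baire" and j :: "nat \<Rightarrow> nat"
  assumes independent: "turing_le (y k) (y i \<oplus> y l) \<Longrightarrow> k = i \<or> k = l"
    and recursive_x: "recursive (\<lambda>_. x t)"
begin

definition f :: "nat \<Rightarrow> baire" where "f m = y (2 * m)"
definition g :: "nat \<Rightarrow> baire" where "g t = y (Suc (2 * t)) \<oplus> x t"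
text \<open>Cutting the label off at \<open>m\<close> leaves \<open>m + 1\<close> possibilities, so
  a finite bound depending on \<open>m\<close> suffices once \<open>f m\<close> is given.\<close>

definition answer :: "nat \<Rightarrow> nat \<Rightarrow> baire" where "answer t m = (\<lambda>_. min (j t) m) \<oplus> (g t \<oplus> f m)"
definition T :: "baire set" where "T = {answer t m | t m. True}"

text \<open>An element \<open>answer s l\<close> of \<open>T\<close> computes the members of the
  family belonging to \<open>s\<close> and \<open>l\<close>. By independence these are among the two
  members computing \<open>z\<close>, and parity tells which is which.\<close>

lemma answer_unique:
  assumes "z \<in> T" "turing_le z (g t \<oplus> h)" "turing_le h (f m)"
  shows "z = answer t m"
proof -
  obtain s l where z: "z = answer s l" using assms(1) by (auto simp: T_def)
  have "turing_le (x t) (y (Suc (2 * t)) \<oplus> f m)"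
    using turing_le_recursive[OF recursive_x] .
  then have "turing_le (g t) (y (Suc (2 * t)) \<oplus> f m)"
    unfolding g_def by (intro turing_le_join turing_le_join_left)
  moreover have "turing_le h (y (Suc (2 * t)) \<oplus> f m)"
    using assms(3) turing_le_join_right by (rule turing_le_trans)
  ultimately have le: "turing_le z (y (Suc (2 * t)) \<oplus> y (2 * m))"
    using assms(2) turing_le_trans turing_le_join unfolding f_def by blast
  have "turing_le (g s \<oplus> f l) z" unfolding z answer_def by (rule turing_le_join_right)
  then have "turing_le (g s) z" "turing_le (f l) z"
    using turing_le_join_left turing_le_join_right turing_le_trans by blast+
  then have "turing_le (y (Suc (2 * s))) z" "turing_le (y (2 * l)) z"
    using turing_le_join_left turing_le_trans unfolding g_def f_def by blast+
  with le have "turing_le (y (Suc (2 * s))) (y (Suc (2 * t)) \<oplus> y (2 * m))"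
    "turing_le (y (2 * l)) (y (Suc (2 * t)) \<oplus> y (2 * m))"
    using turing_le_trans by blast+
  then have "s = t" "l = m" by (auto dest!: independent) presburger+
  then show ?thesis by (simp add: z)
qed

end

text \<open>Leastness makes \<open>C\<close> reducible to \<open>{f m}\<close>, so \<open>C\<close>
  has an element \<open>h\<close> given by an index \<open>d\<close> relative to \<open>f m\<close>.
  In \<open>neg\<close> the number \<open>t\<close> may depend on \<open>d\<close>, but this one
  \<open>t\<close> has to defeat every learner in \<open>S\<close>.\<close>

lemma (in reduction_notion) not_brouwerian:
  assumes "diagonal y x" and
    pos: "\<And>m. red K cnt (diagonal.T y x j) (range (diagonal.g y x) \<otimes> {diagonal.f y m})"
    and neg: "\<And>S k. S \<in> K \<Longrightarrow> \<exists>m. \<forall>d h. Phi d (diagonal.f y m) = Some h \<longrightarrow>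
      (\<exists>t. \<forall>\<psi>\<in>S. \<not> succeeds cnt k \<psi> (diagonal.T y x j) (diagonal.g y x t \<oplus> h))"
  shows "\<not> brouwerian (red K cnt)"
proof
  interpret diagonal y x j by fact
  assume "brouwerian (red K cnt)"
  then obtain C where C: "red K cnt T (range g \<otimes> C)"
    "\<And>D. red K cnt T (range g \<otimes> D) \<Longrightarrow> red K cnt C D"
    unfolding brouwerian_iff by blast
  from C(1) obtain S k where S: "S \<in> K" "\<And>G. G \<in> range g \<otimes> C \<Longrightarrow> \<exists>\<psi>\<in>S. succeeds cnt k \<psi> T G"
    unfolding red_def by blast
  from neg[OF S(1), of k] obtain m where m: "\<And>d h. Phi d (f m) = Some h \<Longrightarrow>
      \<exists>t. \<forall>\<psi>\<in>S. \<not> succeeds cnt k \<psi> T (g t \<oplus> h)" by blast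
  have "red K cnt C {f m}" using C(2) pos by blast
  then obtain d h where h: "h \<in> C" "Phi d (f m) = Some h"
    unfolding red_def succeeds_def by blast
  from m[OF h(2)] obtain t where "\<forall>\<psi>\<in>S. \<not> succeeds cnt k \<psi> T (g t \<oplus> h)" by blast
  moreover have "g t \<oplus> h \<in> range g \<otimes> C" using h(1) unfolding joins_def by blast
  ultimately show False using S(2) by blast
qed

lemma eventually_eq_unique:
  assumes "\<forall>\<^sub>F n in sequentially. v n = i" "\<forall>\<^sub>F n in sequentially. v n = i'"
  shows "i = i'"
proof -
  from assms have "\<forall>\<^sub>F n in sequentially. i = i'" by eventually_elim simp
  then show ?thesis by simp
qed

text \<open>On a given input each learner settles on at most one label, so \<open>b\<close> learner
  indices miss one of the \<open>b + 1\<close> labels up to \<open>b\<close>. The sequence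
  \<open>x\<close> plays no part in this counting and is constantly 0.\<close>

lemma not_brouwerian_finites:
  assumes "closed_class (\<lambda>_ _. 0) L" "L \<subseteq> learners"
  shows "\<not> brouwerian (red (finites L) (\<lambda>_ _. 0))"
proof -
  interpret closed_class "\<lambda>_ _. 0" L by fact
  interpret reduction_notion "\<lambda>_ _. 0" L "finites L" by (rule finites_notion)
  obtain y :: "nat \<Rightarrow> baire" where y: "\<And>k i j. turing_le (y k) (y i \<oplus> y j) \<Longrightarrow> k = i \<or> k = j"
    using ex_independent_family by blast
  define x :: "nat \<Rightarrow> baire" where "x t = (\<lambda>_. 0)" for t
  have diag: "diagonal y x" by unfold_locales (auto simp: x_def y recursive_const)
  \<comment> \<open>\<open>t\<close> codes the index \<open>d\<close> of a reduction and a bound on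
    learner indices. Only those \<open>t\<close> for which the reduction converges enter the
    contradiction, so the arbitrary value of \<open>the\<close> is harmless.\<close>
  define G where "G t = diagonal.g y x t \<oplus> the (Phi (pfst t) (diagonal.f y (psnd t)))" for t
  define out where "out t e c \<longleftrightarrow> (\<exists>\<psi> i z. Psi e = Some \<psi> \<and>
    (\<forall>\<^sub>F n in sequentially. \<psi> (restr (G t) n) = i) \<and> Phi i (G t) = Some z \<and> c = pfst (z 0))" for t e c
  have out_unique: "c = c'" if "out t e c" "out t e c'" for t e c c'
    using that unfolding out_def by (metis eventually_eq_unique option.inject)
  have "\<exists>c\<le>psnd t. \<forall>e<psnd t. \<not> out t e c" for t
  proof (rule ccontr)
    assume "\<not> ?thesis"
    then have "\<forall>c\<in>{..psnd t}. \<exists>e. e < psnd t \<and> out t e c" by auto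
    then obtain E where E: "\<And>c. c \<le> psnd t \<Longrightarrow> E c < psnd t \<and> out t (E c) c" by (metis atMost_iff)
    then have "inj_on E {..psnd t}" by (intro inj_onI) (metis atMost_iff out_unique)
    moreover have "E ` {..psnd t} \<subseteq> {..<psnd t}" using E by auto
    ultimately have "card {..psnd t} \<le> card {..<psnd t}" by (intro card_inj_on_le) auto
    then show False by simp
  qed
  then obtain j where j: "\<And>t. j t \<le> psnd t" "\<And>t e. e < psnd t \<Longrightarrow> \<not> out t e (j t)" by metis
  interpret diagonal y x j by fact
  obtain s where s: "\<And>c g. Phi (s c) g = Some ((\<lambda>_. c) \<oplus> g)" using ex_const_join_index by blast
  show ?thesis
  proof (rule not_brouwerian[OF diag, of j])
    fix m
    have "(\<lambda>c _. s c) ` {..m} \<in> finites L" using const_in by (auto simp: finites_def)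
    moreover have "\<exists>\<psi>\<in>(\<lambda>c _. s c) ` {..m}. succeeds (\<lambda>_ _. 0) 0 \<psi> T G" if G: "G \<in> range g \<otimes> {f m}" for G
    proof -
      obtain t where G: "G = g t \<oplus> f m" using G by (auto simp: joins_def)
      have "Phi (s (min (j t) m)) G = Some (answer t m)" by (simp add: s answer_def G)
      then have "succeeds (\<lambda>_ _. 0) 0 (\<lambda>_. s (min (j t) m)) T G"
        unfolding succeeds_const_iff T_def by blast
      then show ?thesis by (intro bexI[of _ "\<lambda>_. s (min (j t) m)"]) auto
    qed
    ultimately show "red (finites L) (\<lambda>_ _. 0) T (range g \<otimes> {f m})" unfolding red_def by blast
  next
    fix S k assume "S \<in> finites L"
    then have S: "finite S" "S \<subseteq> learners" using assms(2) by (auto simp: finites_def)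
    then have "\<forall>\<psi>\<in>S. \<exists>e. Psi e = Some \<psi>" by (auto simp: learners_def learner_def)
    then obtain E where E: "\<forall>\<psi>\<in>S. Psi (E \<psi>) = Some \<psi>" by metis
    obtain b where b: "\<forall>i\<in>E ` S. i < b" using S(1) finite_nat_set_iff_bounded[of "E ` S"] by auto
    have "\<not> succeeds (\<lambda>_ _. 0) k \<psi> T (g (pair d b) \<oplus> h)"
      if h: "Phi d (f b) = Some h" and \<psi>: "\<psi> \<in> S" for d h \<psi>
    proof
      let ?t = "pair d b"
      have G: "g ?t \<oplus> h = G ?t" by (simp add: G_def h)
      assume "succeeds (\<lambda>_ _. 0) k \<psi> T (g ?t \<oplus> h)"
      then obtain i z where z: "z \<in> T" "\<forall>\<^sub>F n in sequentially. \<psi> (restr (G ?t) n) = i" "Phi i (G ?t) = Some z"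
        unfolding succeeds_zero_iff G by blast
      then have "z = answer ?t b"
        using h by (intro answer_unique[of z ?t h]) (auto simp: turing_le_def G)
      \<comment> \<open>Since \<open>j ?t\<close> is at most \<open>b\<close>, it is not truncated
        in \<open>answer ?t b\<close>; the learner would output precisely the label it was shown to
        miss.\<close>
      then have "pfst (z 0) = j ?t" using j(1)[of ?t] by (simp add: answer_def)
      then have "out ?t (E \<psi>) (j ?t)" unfolding out_def using z E \<psi> by metis
      then show False using j(2) b \<psi> by simp
    qed
    then show "\<exists>m. \<forall>d h. Phi d (f m) = Some h \<longrightarrow>
        (\<exists>t. \<forall>\<psi>\<in>S. \<not> succeeds (\<lambda>_ _. 0) k \<psi> T (g t \<oplus> h))" by blast
  qed
qed

text \<open>A finite game: \<open>x\<close> is held at \<open>k\<close> until the learner shows a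
  hypothesis whose output visibly has label \<open>k\<close>, and is then raised to
  \<open>k + 1\<close>. A learner that always succeeds would be driven to \<open>n + 1\<close>
  different hypotheses.\<close>

lemma ex_defeating:
  fixes \<psi> :: "nat list \<Rightarrow> nat" and r h :: baire and n :: nat
  defines "G \<equiv> \<lambda>x. (r \<oplus> x) \<oplus> h"
  shows "\<exists>x j. recursive (\<lambda>_. x) \<and> mono x \<and> j \<le> n \<and> (\<exists>q. \<forall>u\<ge>q. x u = j) \<and>
    \<not> (\<exists>i z. (\<forall>N. hypotheses (\<lambda>N. \<psi> (restr (G x) N)) N \<le> n) \<and>
      (\<forall>\<^sub>F N in sequentially. \<psi> (restr (G x) N) = i) \<and> Phi i (G x) = Some z \<and> pfst (z 0) = j)"
proof (rule ccontr)
  assume "\<not> ?thesis"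
  then have win: "\<exists>i z. (\<forall>N. hypotheses (\<lambda>N. \<psi> (restr (G x) N)) N \<le> n) \<and>
      (\<forall>\<^sub>F N in sequentially. \<psi> (restr (G x) N) = i) \<and> Phi i (G x) = Some z \<and> pfst (z 0) = j"
    if "recursive (\<lambda>_. x)" "mono x" "j \<le> n" "\<forall>u\<ge>q. x u = j" for x j q
    using that by blast
  have G_cong: "restr (G x') N = restr (G x) N" if "\<forall>u<q. x' u = x u" "N \<le> q" for x x' q N
    using that by (intro restr_cong) (simp add: G_def join_def)
  \<comment> \<open>The hypotheses in \<open>E\<close> were made on the part of \<open>x\<close> below \<open>q\<close>, and that part of \<open>x\<close> commits
    each of them to an answer less than \<open>k\<close>.\<close>
  define state where "state k x q E \<longleftrightarrow> recursive (\<lambda>_. x) \<and> mono x \<and> (\<forall>u\<ge>q. x u = k) \<and> finite E \<and> card E = k \<and>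
    E \<subseteq> (\<lambda>N. \<psi> (restr (G x) N)) ` {..q} \<and>
    (\<forall>i\<in>E. \<forall>x'. (\<forall>u<q. x' u = x u) \<longrightarrow> (\<forall>z. Phi i (G x') = Some z \<longrightarrow> pfst (z 0) < k))" for k x q E
  have committed: "pfst (z 0) < k"
    if "state k x q E" "i \<in> E" "\<forall>u<q. x' u = x u" "Phi i (G x') = Some z" for k x q E i x' z
    using that unfolding state_def by blast
  have next_hyp: "\<exists>i q' z. q \<le> q' \<and> i \<notin> E \<and> i \<in> (\<lambda>N. \<psi> (restr (G x) N)) ` {..q'} \<and>
      run i (rcode (G x) q') 0 q' = Suc z \<and> pfst z = k \<and> (\<forall>N. hypotheses (\<lambda>N. \<psi> (restr (G x) N)) N \<le> n)"
    if st: "state k x q E" and "k \<le> n" for k x q E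
  proof -
    from win[of x k q] st \<open>k \<le> n\<close> obtain i z where i: "\<forall>N. hypotheses (\<lambda>N. \<psi> (restr (G x) N)) N \<le> n"
      "\<forall>\<^sub>F N in sequentially. \<psi> (restr (G x) N) = i" "Phi i (G x) = Some z" "pfst (z 0) = k"
      unfolding state_def by blast
    obtain N where N: "\<psi> (restr (G x) N) = i" using i(2) unfolding eventually_sequentially by blast
    obtain M where M: "\<forall>n\<ge>M. \<forall>t\<ge>M. run i (rcode (G x) n) 0 t = Suc (z 0)"
      using run_complete[OF i(3)] by blast
    \<comment> \<open>Every output of a hypothesis in \<open>E\<close> has a label below
      \<open>k\<close>, whereas the limit hypothesis on the current \<open>x\<close> produces label
      \<open>k\<close>.\<close>
    have "i \<notin> E" using committed[OF st _ _ i(3)] i(4) by blast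
    then show ?thesis
      using M N i by (intro exI[of _ i] exI[of _ "max q (max N M)"] exI[of _ "z 0"]) auto
  qed
  have "\<exists>x q E. state k x q E" if "k \<le> n" for k
    using that
  proof (induction k)
    case 0
    have "state 0 (\<lambda>_. 0) 0 {}" by (simp add: state_def recursive_const mono_def)
    then show ?case by blast
  next
    case (Suc k)
    then obtain x q E where st: "state k x q E" by auto
    from next_hyp[OF st] Suc.prems obtain i q' z where i: "q \<le> q'" "i \<notin> E"
      "i \<in> (\<lambda>N. \<psi> (restr (G x) N)) ` {..q'}" "run i (rcode (G x) q') 0 q' = Suc z" "pfst z = k"
      by (meson Suc_leD)
    \<comment> \<open>The jump starts at \<open>q'\<close>, when the finite part of the input
      already fixes the label of \<open>i\<close>, so the commitment survives any later
      change.\<close>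
    define x' where "x' u = (if u < q' then x u else Suc k)" for u
    have "x u \<le> k" for u
      using st unfolding state_def by (metis le_cases monoD order_refl)
    then have "mono x'" using st by (auto simp: x'_def mono_def state_def intro: le_SucI)
    moreover have "recursive (\<lambda>_. x')"
      using st unfolding x'_def state_def by (intro recursive_intros) auto
    moreover have hyps: "(\<lambda>N. \<psi> (restr (G x') N)) ` {..q'} = (\<lambda>N. \<psi> (restr (G x) N)) ` {..q'}"
      by (intro image_cong) (auto simp: x'_def G_cong[of q' x' x])
    have "insert i E \<subseteq> (\<lambda>N. \<psi> (restr (G x') N)) ` {..q'}"
      unfolding hyps using i(1,3) st unfolding state_def by fastforce
    moreover have "pfst (z' 0) < Suc k"
      if "i' \<in> insert i E" "\<forall>u<q'. x'' u = x' u" "Phi i' (G x'') = Some z'" for i' x'' z'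
    proof (cases "i' = i")
      case True
      have "rcode (G x'') q' = rcode (G x) q'" using that(2) by (subst G_cong[of q']) (auto simp: x'_def)
      then have "z' 0 = z" using run_sound[of i "G x''" z' q' 0 q' z] i(4) that(3) True by simp
      then show ?thesis using i(5) by simp
    next
      case False
      then have "pfst (z' 0) < k"
        using that i(1) by (intro committed[OF st, of i' x'' z']) (auto simp: x'_def)
      then show ?thesis by simp
    qed
    ultimately have "state (Suc k) x' q' (insert i E)"
      using st i(2) unfolding state_def by (auto simp: x'_def)
    then show ?case by blast
  qed
  then obtain x q E where st: "state n x q E" by blast
  from next_hyp[OF st] obtain i q' where i: "q \<le> q'" "i \<notin> E" "i \<in> (\<lambda>N. \<psi> (restr (G x) N)) ` {..q'}"
    "\<forall>N. hypotheses (\<lambda>N. \<psi> (restr (G x) N)) N \<le> n" by blast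
  \<comment> \<open>At \<open>k = n\<close> no jump follows: the new limit hypothesis together with
    the \<open>n\<close> in \<open>E\<close> already exceeds the bound.\<close>
  have "insert i E \<subseteq> (\<lambda>N. \<psi> (restr (G x) N)) ` {..q'}"
    using i(1,3) st unfolding state_def by fastforce
  then have "card (insert i E) \<le> hypotheses (\<lambda>N. \<psi> (restr (G x) N)) q'"
    unfolding hypotheses_def by (intro card_mono) auto
  also have "\<dots> \<le> n" using i(4) by blast
  finally show False using st i(2) by (simp add: state_def)
qed

text \<open>The assumption \<open>hyp\<close> turns a bound \<open>l\<close> on the count into the
  bound \<open>Suc l\<close> on hypotheses, so one diagonalisation serves mind changes and
  hypotheses alike.\<close>

lemma (in counter) not_brouwerian_singles:
  assumes hyp: "\<And>v n. hypotheses v n \<le> Suc (cnt v n)"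
  shows "\<not> brouwerian (red (singles learners) cnt)"
proof -
  interpret closed_class cnt learners by (rule learners_closed)
  interpret reduction_notion cnt learners "singles learners" by (rule singles_notion)
  obtain y :: "nat \<Rightarrow> baire" where y: "\<And>k i j. turing_le (y k) (y i \<oplus> y j) \<Longrightarrow> k = i \<or> k = j"
    using ex_independent_family by blast
  \<comment> \<open>The index \<open>t\<close> codes a reduction \<open>d\<close>, a learner \<open>e\<close> and a bound \<open>k\<close>.\<close>
  define d where "d = pfst"
  define e where "e t = pfst (psnd t)" for t
  define k where "k t = psnd (psnd t)" for t
  define G where "G t x = (y (Suc (2 * t)) \<oplus> x) \<oplus> the (Phi (d t) (y (2 * Suc (k t))))" for t x
  define ok where "ok t x j \<longleftrightarrow> recursive (\<lambda>_. x) \<and> mono x \<and> j \<le> Suc (k t) \<and> (\<exists>q. \<forall>u\<ge>q. x u = j) \<and>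
    \<not> (\<exists>i z. (\<forall>N. hypotheses (\<lambda>N. the (Psi (e t)) (restr (G t x) N)) N \<le> Suc (k t)) \<and>
      (\<forall>\<^sub>F N in sequentially. the (Psi (e t)) (restr (G t x) N) = i) \<and> Phi i (G t x) = Some z \<and> pfst (z 0) = j)"
    for t x j
  have "\<forall>t. \<exists>x j. ok t x j" unfolding ok_def G_def by (intro allI ex_defeating)
  then obtain x j where ok: "\<And>t. ok t (x t) (j t)" by metis
  have diag: "diagonal y x" by unfold_locales (use ok y in \<open>auto simp: ok_def\<close>)
  interpret diagonal y x j by fact
  obtain s where s: "recursive (\<lambda>_. s)" "\<And>c g. Phi (s c) g = Some ((\<lambda>_. c) \<oplus> g)"
    using ex_const_join_index by blast
  show ?thesis
  proof (rule not_brouwerian[OF diag, of j])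
    fix m
    \<comment> \<open>The current hypothesis attaches the newest visible entry of
      \<open>x t\<close>, cut off at \<open>m\<close>, as label. On the empty prefix
      \<open>lookup\<close> returns 0 and the label is 0, whence the case \<open>n = 0\<close> of
      \<open>v\<close> below.\<close>
    define \<psi> where "\<psi> \<sigma> = s (min (psnd (pfst (lookup (list_encode \<sigma>) (length \<sigma> - 1) - 1))) m)" for \<sigma>
    \<comment> \<open>Binding with a constant second sequence bounds the count after labels are
      turned into indices by \<open>s\<close>.\<close>
    obtain b where b: "\<And>v u F n. \<forall>n. cnt v n \<le> Suc m \<Longrightarrow> \<forall>i n. cnt (u i) n \<le> 1 \<Longrightarrow>
        cnt (\<lambda>n. F (v n) (u (v n) n)) n \<le> b"
      using ex_cnt_bind[of "Suc m" 1] by blast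
    have "learner \<psi>"
      unfolding learner_iff \<psi>_def by (intro recursive_comp[OF s(1)] recursive_intros)
    moreover have "succeeds cnt b \<psi> T G" if G: "G \<in> range g \<otimes> {f m}" for G
    proof -
      obtain t where G: "G = g t \<oplus> f m" using G by (auto simp: joins_def)
      have x: "mono (x t)" "\<exists>q. \<forall>u\<ge>q. x t u = j t" using ok[of t] by (auto simp: ok_def)
      define v where "v n = (if n = 0 then 0 else min (x t (n - 1)) m)" for n
      have \<psi>: "\<psi> (restr G n) = s (v n)" for n
        by (cases n) (simp_all add: \<psi>_def v_def lookup_rcode G g_def prod_decode_0)
      have "mono v"
      proof (rule monoI)
        fix a b :: nat assume "a \<le> b"
        then show "v a \<le> v b" using monoD[OF x(1) diff_le_mono, of a b 1] by (auto simp: v_def min_def)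
      qed
      then have "cnt v n \<le> Suc m" for n by (intro cnt_mono_le) (auto simp: v_def)
      then have "cnt (\<lambda>n. \<psi> (restr G n)) n \<le> b" for n
        unfolding \<psi> using b[of v "\<lambda>_ _. 0" "\<lambda>i _. s i" n] cnt_const by simp
      moreover have "\<forall>\<^sub>F n in sequentially. \<psi> (restr G n) = s (min (j t) m)"
      proof -
        obtain q where "\<forall>u\<ge>q. x t u = j t" using x(2) by blast
        then have "\<psi> (restr G n) = s (min (j t) m)" if "n \<ge> Suc q" for n
          using that by (auto simp: \<psi> v_def)
        then show ?thesis unfolding eventually_sequentially by blast
      qed
      moreover have "Phi (s (min (j t) m)) G = Some (answer t m)" by (simp add: s answer_def G)
      ultimately show ?thesis unfolding succeeds_def T_def by blast
    qed
    ultimately show "red (singles learners) cnt T (range g \<otimes> {f m})"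
      unfolding red_single_learners by blast
  next
    fix S l assume "S \<in> singles learners"
    then obtain \<psi> e' where S: "S = {\<psi>}" and \<psi>: "Psi e' = Some \<psi>"
      by (auto simp: singles_def learners_def learner_def)
    have "\<not> succeeds cnt l \<psi> T (g (pair c (pair e' l)) \<oplus> h)" if h: "Phi c (f (Suc l)) = Some h" for c h
    proof
      let ?t = "pair c (pair e' l)"
      have t: "d ?t = c" "e ?t = e'" "k ?t = l" by (simp_all add: d_def e_def k_def)
      have G: "g ?t \<oplus> h = G ?t (x ?t)" using h by (simp add: G_def t g_def f_def)
      assume "succeeds cnt l \<psi> T (g ?t \<oplus> h)"
      then obtain i z where z: "z \<in> T" "\<forall>\<^sub>F n in sequentially. \<psi> (restr (G ?t (x ?t)) n) = i"
        "Phi i (G ?t (x ?t)) = Some z" and l: "\<forall>n. cnt (\<lambda>n. \<psi> (restr (G ?t (x ?t)) n)) n \<le> l"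
        unfolding succeeds_def G by blast
      have "hypotheses (\<lambda>n. \<psi> (restr (G ?t (x ?t)) n)) n \<le> Suc l" for n
        using hyp l by (meson Suc_le_mono le_trans)
      \<comment> \<open>The choice \<open>m = Suc l\<close> matches the bound
        \<open>j ?t \<le> Suc l\<close>, so the label in this answer is \<open>j ?t\<close>
        itself.\<close>
      moreover have "z = answer ?t (Suc l)"
        using h z by (intro answer_unique[of z ?t h]) (auto simp: turing_le_def G)
      then have "pfst (z 0) = j ?t" using ok[of ?t] by (simp add: answer_def ok_def t)
      ultimately show False using ok[of ?t] z(2,3) by (auto simp: ok_def t \<psi>)
    qed
    then show "\<exists>m. \<forall>c h. Phi c (f m) = Some h \<longrightarrow> (\<exists>t. \<forall>\<psi>\<in>S. \<not> succeeds cnt l \<psi> T (g t \<oplus> h))"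
      unfolding S by blast
  qed
qed

theorem corollary87:
  fixes C D :: "(baire \<rightharpoonup> baire) \<Rightarrow> bool"
  assumes "C \<in> {computable_1_1, computable_1_omega, computable_omega_1}"
    and "D \<in> {computable_1_fin, computable_1_omega_fin, computable_fin_1, computable_fin_omega}"
  shows "\<exists>\<phi>. sentence \<phi> \<and>
    (true_in (degrees C) (degree_le C) \<phi> \<longleftrightarrow> \<not> true_in (degrees D) (degree_le D) \<phi>)"
proof -
  have "true_in (degrees C) (degree_le C) brouwer_fm \<longleftrightarrow> brouwerian (reducible C)"
    using assms(1) by (intro true_in_brouwer_fm)
      (auto simp: reducible_1_1 reducible_1_omega reducible_omega_1
        intro: medvedev.red_refl muchnik.red_refl one_omega.red_refl
        medvedev.red_trans muchnik.red_trans one_omega.red_trans)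
  moreover have "brouwerian (reducible C)"
    using assms(1) brouwerian_medvedev brouwerian_muchnik brouwerian_one_omega
    by (auto simp: reducible_1_1 reducible_1_omega reducible_omega_1)
  moreover have "true_in (degrees D) (degree_le D) brouwer_fm \<longleftrightarrow> brouwerian (reducible D)"
    using assms(2) by (intro true_in_brouwer_fm)
      (auto simp: reducible_1_fin reducible_1_omega_fin reducible_fin_1 reducible_fin_omega
        intro: one_fin.red_refl one_omega_fin.red_refl fin_1.red_refl fin_omega.red_refl
        one_fin.red_trans one_omega_fin.red_trans fin_1.red_trans fin_omega.red_trans)
  moreover have "\<not> brouwerian (reducible D)"
  proof -
    have "constants \<subseteq> learners"
      by (auto simp: constants_def learners_def learner_iff recursive_const)
    then have "\<not> brouwerian (red (finites constants) (\<lambda>_ _. 0))"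
      "\<not> brouwerian (red (finites learners) (\<lambda>_ _. 0))"
      using not_brouwerian_finites constants_closed zero.learners_closed by blast+
    moreover have "\<not> brouwerian (red (singles learners) mind_changes)"
      by (rule mind_changes.not_brouwerian_singles) (rule hypotheses_le)
    moreover have "\<not> brouwerian (red (singles learners) hypotheses)"
      by (rule hypotheses.not_brouwerian_singles) simp
    ultimately show ?thesis
      using assms(2) by (auto simp: reducible_1_fin reducible_1_omega_fin reducible_fin_1 reducible_fin_omega)
  qed
  ultimately show ?thesis using sentence_brouwer_fm by blast
qed

end
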